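(* Let $\Gamma=(V,E,s,r)$ be an arbitrary directed graph and let $S$ be a commutative semiring. If the Leavitt path algebra $L_S(\Gamma)$ is congruence-simple, then it is ideal-simple as well.
   Context: Semirings. A hemiring $(R,+,\cdot,0)$ is a set such that $(R,+,0)$ is a commutative monoid, $(R,\cdot)$ is a semigroup, multiplication distributes over addition from either side, and $0x=0=x0$ for all $x\in R$. A semiring is a hemiring with a multiplicative identity $1$; it is commutative if its multiplication is. An ideal of a hemiring $R$ is a submonoid $I$ of $(R,+,0)$ with $xa, ax\in I$ for all $a\in I$, $x\in R$. A hemiring $R$ is ideal-simple if $0$ and $R$ are its only ideals. A congruence on a hemiring $R$ is an equivalence relation $\rho$ on $R$ such that $(x+a,x+b),(xa,xb),(ax,bx)\in\rho$ for all $(a,b)\in\rho$, $x\in R$. A hemiring $R$ is congruence-simple if the diagonal $\{(x,x)\mid x\in R\}$ and $R^2$ are its only congruences. An $S$-algebra over a commutative semiring $S$ is an $S$-semimodule with an associative $S$-bilinear multiplication (not necessarily unital). Graphs. A directed graph $\Gamma=(V,E,s,r)$ consists of disjoint sets $V$ (vertices) and $E$ (edges) and maps $s,r:E\to V$ (source, range). A vertex $v$ is regular if $0<|s^{-1}(v)|<\infty$. Leavitt path algebra. For a commutative semiring $S$, $L_S(\Gamma)$ is the $S$-algebra presented by generators $V\cup E\cup E^*$, where $E\to E^*$, $e\mapsto e^*$, is a bijection and $V,E,E^*$ are pairwise disjoint, and relations: (1) $vv'=\delta_{v,v'}v$ for $v,v'\in V$; (2) $s(e)e=e=e\,r(e)$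 and $r(e)e^*=e^*=e^*s(e)$ for $e\in E$; (3) $e^*f=\delta_{e,f}r(e)$ for $e,f\in E$; (4) $v=\sum_{e\in s^{-1}(v)}ee^*$ for every regular vertex $v$. *)

theory Defs
  imports "HOL-Algebra.Module" "Graph_Theory.Digraph"
begin

section \<open>Hemirings, ideals and congruences\<close>

text \<open>
  Structures are the records of HOL-Algebra. Hemirings need not have a unit, so nothing below refers
  to the field \<open>one\<close>.
\<close>

locale hemiring = abelian_monoid R for R (structure) +
  assumes m_closed: "\<lbrakk>x \<in> carrier R; y \<in> carrier R\<rbrakk> \<Longrightarrow> x \<otimes> y \<in> carrier R"
    and m_assoc: "\<lbrakk>x \<in> carrier R; y \<in> carrier R; z \<in> carrier R\<rbrakk>
                    \<Longrightarrow> (x \<otimes> y) \<otimes> z = x \<otimes> (y \<otimes> z)"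
    and l_distr: "\<lbrakk>x \<in> carrier R; y \<in> carrier R; z \<in> carrier R\<rbrakk>
                    \<Longrightarrow> (x \<oplus> y) \<otimes> z = x \<otimes> z \<oplus> y \<otimes> z"
    and r_distr: "\<lbrakk>x \<in> carrier R; y \<in> carrier R; z \<in> carrier R\<rbrakk>
                    \<Longrightarrow> z \<otimes> (x \<oplus> y) = z \<otimes> x \<oplus> z \<otimes> y"
    and l_null: "x \<in> carrier R \<Longrightarrow> \<zero> \<otimes> x = \<zero>"
    and r_null: "x \<in> carrier R \<Longrightarrow> x \<otimes> \<zero> = \<zero>"

definition hemiring_ideal :: "('a, 'm) ring_scheme \<Rightarrow> 'a set \<Rightarrow> bool" where
  "hemiring_ideal R I \<longleftrightarrow>
     submonoid I (add_monoid R) \<and>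
     (\<forall>a\<in>I. \<forall>x\<in>carrier R. x \<otimes>\<^bsub>R\<^esub> a \<in> I \<and> a \<otimes>\<^bsub>R\<^esub> x \<in> I)"

definition ideal_simple :: "('a, 'm) ring_scheme \<Rightarrow> bool" where
  "ideal_simple R \<longleftrightarrow> (\<forall>I. hemiring_ideal R I \<longrightarrow> I = {\<zero>\<^bsub>R\<^esub>} \<or> I = carrier R)"

definition hemiring_congruence :: "('a, 'm) ring_scheme \<Rightarrow> 'a rel \<Rightarrow> bool" where
  "hemiring_congruence R \<rho> \<longleftrightarrow>
     equiv (carrier R) \<rho> \<and>
     (\<forall>(a, b)\<in>\<rho>. \<forall>x\<in>carrier R.
        (x \<oplus>\<^bsub>R\<^esub> a, x \<oplus>\<^bsub>R\<^esub> b) \<in> \<rho> \<and>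
        (x \<otimes>\<^bsub>R\<^esub> a, x \<otimes>\<^bsub>R\<^esub> b) \<in> \<rho> \<and>
        (a \<otimes>\<^bsub>R\<^esub> x, b \<otimes>\<^bsub>R\<^esub> x) \<in> \<rho>)"

definition congruence_simple :: "('a, 'm) ring_scheme \<Rightarrow> bool" where
  "congruence_simple R \<longleftrightarrow>
     (\<forall>\<rho>. hemiring_congruence R \<rho> \<longrightarrow> \<rho> = Id_on (carrier R) \<or> \<rho> = carrier R \<times> carrier R)"


section \<open>Algebras over a commutative semiring\<close>

text \<open>
  The scalars form a type of sort \<open>{comm_semiring_0, comm_monoid_mult}\<close>, i.e. a commutative semiring
  with unit. The class \<open>comm_semiring_1\<close> would moreover force \<open>0 \<noteq> 1\<close>.
\<close>

locale semiring_algebra = hemiring A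
  for A :: "('s::{comm_semiring_0, comm_monoid_mult}, 'a, 'm) module_scheme" (structure) +
  assumes smult_closed: "x \<in> carrier A \<Longrightarrow> s \<odot> x \<in> carrier A"
    and smult_r_distr: "\<lbrakk>x \<in> carrier A; y \<in> carrier A\<rbrakk> \<Longrightarrow> s \<odot> (x \<oplus> y) = s \<odot> x \<oplus> s \<odot> y"
    and smult_l_distr: "x \<in> carrier A \<Longrightarrow> (s + t) \<odot> x = s \<odot> x \<oplus> t \<odot> x"
    and smult_assoc: "x \<in> carrier A \<Longrightarrow> (s * t) \<odot> x = s \<odot> (t \<odot> x)"
    and smult_one: "x \<in> carrier A \<Longrightarrow> 1 \<odot> x = x"
    and smult_l_null: "x \<in> carrier A \<Longrightarrow> 0 \<odot> x = \<zero>"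
    and smult_r_null: "s \<odot> \<zero> = \<zero>"
    and smult_mult_l: "\<lbrakk>x \<in> carrier A; y \<in> carrier A\<rbrakk> \<Longrightarrow> (s \<odot> x) \<otimes> y = s \<odot> (x \<otimes> y)"
    and smult_mult_r: "\<lbrakk>x \<in> carrier A; y \<in> carrier A\<rbrakk> \<Longrightarrow> x \<otimes> (s \<odot> y) = s \<odot> (x \<otimes> y)"


section \<open>Algebras presented by generators and relations\<close>

text \<open>
  The algebra with generators \<open>X\<close> and relations \<open>\<R>\<close> consists of the formal expressions over \<open>X\<close> in
  the operations of an algebra, modulo the least equivalence relation that is compatible with the
  operations and contains \<open>\<R>\<close> and all instances of the algebra axioms.
\<close>

datatype ('s, gens: 'x) alg_term =
  TGen 'x
| TZero
| TAdd "('s, 'x) alg_term" "('s, 'x) alg_term"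
| TMult "('s, 'x) alg_term" "('s, 'x) alg_term"
| TSmult 's "('s, 'x) alg_term"

definition terms_over :: "'x set \<Rightarrow> ('s, 'x) alg_term set" where
  "terms_over X = {t. gens t \<subseteq> X}"

inductive algebra_axiom ::
  "('s::{comm_semiring_0, comm_monoid_mult}, 'x) alg_term \<Rightarrow> ('s, 'x) alg_term \<Rightarrow> bool" where
  "algebra_axiom (TAdd (TAdd x y) z) (TAdd x (TAdd y z))"
| "algebra_axiom (TAdd x y) (TAdd y x)"
| "algebra_axiom (TAdd TZero x) x"
| "algebra_axiom (TMult (TMult x y) z) (TMult x (TMult y z))"
| "algebra_axiom (TMult (TAdd x y) z) (TAdd (TMult x z) (TMult y z))"
| "algebra_axiom (TMult z (TAdd x y)) (TAdd (TMult z x) (TMult z y))"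
| "algebra_axiom (TMult TZero x) TZero"
| "algebra_axiom (TMult x TZero) TZero"
| "algebra_axiom (TSmult s (TAdd x y)) (TAdd (TSmult s x) (TSmult s y))"
| "algebra_axiom (TSmult (s + t) x) (TAdd (TSmult s x) (TSmult t x))"
| "algebra_axiom (TSmult (s * t) x) (TSmult s (TSmult t x))"
| "algebra_axiom (TSmult 1 x) x"
| "algebra_axiom (TSmult 0 x) TZero"
| "algebra_axiom (TSmult s TZero) TZero"
| "algebra_axiom (TMult (TSmult s x) y) (TSmult s (TMult x y))"
| "algebra_axiom (TMult x (TSmult s y)) (TSmult s (TMult x y))"

inductive_set presentation_cong ::
  "'x set \<Rightarrow> ('s::{comm_semiring_0, comm_monoid_mult}, 'x) alg_term rel \<Rightarrow> ('s, 'x) alg_term rel"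
  for X \<R> where
  rel: "\<lbrakk>(t, u) \<in> \<R>; t \<in> terms_over X; u \<in> terms_over X\<rbrakk> \<Longrightarrow> (t, u) \<in> presentation_cong X \<R>"
| ax: "\<lbrakk>algebra_axiom t u; t \<in> terms_over X; u \<in> terms_over X\<rbrakk> \<Longrightarrow> (t, u) \<in> presentation_cong X \<R>"
| refl: "t \<in> terms_over X \<Longrightarrow> (t, t) \<in> presentation_cong X \<R>"
| sym: "(t, u) \<in> presentation_cong X \<R> \<Longrightarrow> (u, t) \<in> presentation_cong X \<R>"
| trans: "\<lbrakk>(t, u) \<in> presentation_cong X \<R>; (u, w) \<in> presentation_cong X \<R>\<rbrakk>
            \<Longrightarrow> (t, w) \<in> presentation_cong X \<R>"
| add: "\<lbrakk>(t, u) \<in> presentation_cong X \<R>; (t', u') \<in> presentation_cong X \<R>\<rbrakk>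
          \<Longrightarrow> (TAdd t t', TAdd u u') \<in> presentation_cong X \<R>"
| mult: "\<lbrakk>(t, u) \<in> presentation_cong X \<R>; (t', u') \<in> presentation_cong X \<R>\<rbrakk>
          \<Longrightarrow> (TMult t t', TMult u u') \<in> presentation_cong X \<R>"
| smult: "(t, u) \<in> presentation_cong X \<R> \<Longrightarrow> (TSmult s t, TSmult s u) \<in> presentation_cong X \<R>"

definition term_class ::
  "'x set \<Rightarrow> ('s::{comm_semiring_0, comm_monoid_mult}, 'x) alg_term rel
     \<Rightarrow> ('s, 'x) alg_term \<Rightarrow> ('s, 'x) alg_term set" where
  "term_class X \<R> t = presentation_cong X \<R> `` {t}"

definition presented_algebra ::
  "'x set \<Rightarrow> ('s::{comm_semiring_0, comm_monoid_mult}, 'x) alg_term rel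
     \<Rightarrow> ('s, ('s, 'x) alg_term set) module" where
  "presented_algebra X \<R> =
     \<lparr>carrier = terms_over X // presentation_cong X \<R>,
      mult = (\<lambda>a b. \<Union>t\<in>a. \<Union>u\<in>b. term_class X \<R> (TMult t u)),
      one = undefined,
      zero = term_class X \<R> TZero,
      add = (\<lambda>a b. \<Union>t\<in>a. \<Union>u\<in>b. term_class X \<R> (TAdd t u)),
      smult = (\<lambda>s a. \<Union>t\<in>a. term_class X \<R> (TSmult s t))\<rparr>"


section \<open>Leavitt path algebras\<close>

text \<open>Source and range of an edge are \<open>tail\<close> and \<open>head\<close>, and \<open>s\<inverse>(v)\<close> is \<open>out_arcs G v\<close>.\<close>

definition regular_vertex :: "('v, 'e) pre_digraph \<Rightarrow> 'v \<Rightarrow> bool" where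
  "regular_vertex G v \<longleftrightarrow> v \<in> verts G \<and> finite (out_arcs G v) \<and> out_arcs G v \<noteq> {}"

datatype ('v, 'e) leavitt_gen = Vertex 'v | Edge 'e | Ghost 'e

definition leavitt_gens :: "('v, 'e) pre_digraph \<Rightarrow> ('v, 'e) leavitt_gen set" where
  "leavitt_gens G = Vertex ` verts G \<union> Edge ` arcs G \<union> Ghost ` arcs G"

text \<open>
  In \<open>cuntz_krieger2\<close> the sum over \<open>out_arcs G v\<close> is written out along every enumeration \<open>es\<close> of this
  set; modulo the algebra axioms all enumerations give the same relation.
\<close>

inductive_set leavitt_relations ::
  "('v, 'e) pre_digraph
     \<Rightarrow> ('s::{comm_semiring_0, comm_monoid_mult}, ('v, 'e) leavitt_gen) alg_term rel"
  for G :: "('v, 'e) pre_digraph" where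
  vertex_same: "v \<in> verts G \<Longrightarrow>
    (TMult (TGen (Vertex v)) (TGen (Vertex v)), TGen (Vertex v)) \<in> leavitt_relations G"
| vertex_diff: "\<lbrakk>v \<in> verts G; v' \<in> verts G; v \<noteq> v'\<rbrakk> \<Longrightarrow>
    (TMult (TGen (Vertex v)) (TGen (Vertex v')), TZero) \<in> leavitt_relations G"
| source_edge: "e \<in> arcs G \<Longrightarrow>
    (TMult (TGen (Vertex (tail G e))) (TGen (Edge e)), TGen (Edge e)) \<in> leavitt_relations G"
| edge_range: "e \<in> arcs G \<Longrightarrow>
    (TMult (TGen (Edge e)) (TGen (Vertex (head G e))), TGen (Edge e)) \<in> leavitt_relations G"
| range_ghost: "e \<in> arcs G \<Longrightarrow>
    (TMult (TGen (Vertex (head G e))) (TGen (Ghost e)), TGen (Ghost e)) \<in> leavitt_relations G"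
| ghost_source: "e \<in> arcs G \<Longrightarrow>
    (TMult (TGen (Ghost e)) (TGen (Vertex (tail G e))), TGen (Ghost e)) \<in> leavitt_relations G"
| cuntz_krieger1_same: "e \<in> arcs G \<Longrightarrow>
    (TMult (TGen (Ghost e)) (TGen (Edge e)), TGen (Vertex (head G e))) \<in> leavitt_relations G"
| cuntz_krieger1_diff: "\<lbrakk>e \<in> arcs G; f \<in> arcs G; e \<noteq> f\<rbrakk> \<Longrightarrow>
    (TMult (TGen (Ghost e)) (TGen (Edge f)), TZero) \<in> leavitt_relations G"
| cuntz_krieger2: "\<lbrakk>regular_vertex G v; distinct es; set es = out_arcs G v\<rbrakk> \<Longrightarrow>
    (TGen (Vertex v),
     foldr (\<lambda>e. TAdd (TMult (TGen (Edge e)) (TGen (Ghost e)))) es TZero) \<in> leavitt_relations G"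

definition leavitt_path_algebra ::
  "'s::{comm_semiring_0, comm_monoid_mult} itself \<Rightarrow> ('v, 'e) pre_digraph
     \<Rightarrow> ('s, ('s, ('v, 'e) leavitt_gen) alg_term set) module" where
  "leavitt_path_algebra _ G = presented_algebra (leavitt_gens G) (leavitt_relations G)"


section \<open>Basic facts\<close>

lemma terms_over_simps [simp]:
  "TGen x \<in> terms_over X \<longleftrightarrow> x \<in> X"
  "TZero \<in> terms_over X"
  "TAdd t u \<in> terms_over X \<longleftrightarrow> t \<in> terms_over X \<and> u \<in> terms_over X"
  "TMult t u \<in> terms_over X \<longleftrightarrow> t \<in> terms_over X \<and> u \<in> terms_over X"
  "TSmult s t \<in> terms_over X \<longleftrightarrow> t \<in> terms_over X"
  by (auto simp: terms_over_def)

lemma presentation_cong_closed: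
  "(t, u) \<in> presentation_cong X \<R> \<Longrightarrow> t \<in> terms_over X \<and> u \<in> terms_over X"
  by (induction rule: presentation_cong.induct) auto

lemma equiv_presentation_cong: "equiv (terms_over X) (presentation_cong X \<R>)"
proof (rule equivI)
  show "presentation_cong X \<R> \<subseteq> terms_over X \<times> terms_over X"
    using presentation_cong_closed by fastforce
  show "refl_on (terms_over X) (presentation_cong X \<R>)"
    by (rule refl_onI) (rule presentation_cong.refl)
  show "sym (presentation_cong X \<R>)"
    by (rule symI) (rule presentation_cong.sym)
  show "trans (presentation_cong X \<R>)"
    by (rule transI) (rule presentation_cong.trans)
qed

lemma term_class_eq_iff:
  assumes "t \<in> terms_over X" "u \<in> terms_over X"
  shows "term_class X \<R> t = term_class X \<R> u \<longleftrightarrow> (t, u) \<in> presentation_cong X \<R>"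
  unfolding term_class_def using eq_equiv_class_iff[OF equiv_presentation_cong assms] .

lemma term_class_cong:
  "(t, u) \<in> presentation_cong X \<R> \<Longrightarrow> term_class X \<R> t = term_class X \<R> u"
  unfolding term_class_def by (rule equiv_class_eq[OF equiv_presentation_cong])

lemma carrier_presented_algebra:
  "carrier (presented_algebra X \<R>) = term_class X \<R> ` terms_over X"
  by (auto simp: presented_algebra_def quotient_def term_class_def)

lemma zero_presented_algebra: "\<zero>\<^bsub>presented_algebra X \<R>\<^esub> = term_class X \<R> TZero"
  by (simp add: presented_algebra_def)

lemma add_presented_algebra:
  assumes "t \<in> terms_over X" "u \<in> terms_over X"
  shows "term_class X \<R> t \<oplus>\<^bsub>presented_algebra X \<R>\<^esub> term_class X \<R> u = term_class X \<R> (TAdd t u)"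
proof -
  have "congruent2 (presentation_cong X \<R>) (presentation_cong X \<R>) (\<lambda>t u. term_class X \<R> (TAdd t u))"
    unfolding congruent2_def
    by (auto intro!: term_class_cong presentation_cong.add)
  from UN_equiv_class2[OF equiv_presentation_cong equiv_presentation_cong this assms]
  show ?thesis by (simp add: presented_algebra_def flip: term_class_def)
qed

lemma mult_presented_algebra:
  assumes "t \<in> terms_over X" "u \<in> terms_over X"
  shows "term_class X \<R> t \<otimes>\<^bsub>presented_algebra X \<R>\<^esub> term_class X \<R> u = term_class X \<R> (TMult t u)"
proof -
  have "congruent2 (presentation_cong X \<R>) (presentation_cong X \<R>) (\<lambda>t u. term_class X \<R> (TMult t u))"
    unfolding congruent2_def
    by (auto intro!: term_class_cong presentation_cong.mult)
  from UN_equiv_class2[OF equiv_presentation_cong equiv_presentation_cong this assms]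
  show ?thesis by (simp add: presented_algebra_def flip: term_class_def)
qed

lemma smult_presented_algebra:
  assumes "t \<in> terms_over X"
  shows "s \<odot>\<^bsub>presented_algebra X \<R>\<^esub> term_class X \<R> t = term_class X \<R> (TSmult s t)"
proof -
  have "congruent (presentation_cong X \<R>) (\<lambda>t. term_class X \<R> (TSmult s t))"
    unfolding congruent_def
    by (auto intro!: term_class_cong presentation_cong.smult)
  from UN_equiv_class[OF equiv_presentation_cong this assms]
  show ?thesis by (simp add: presented_algebra_def flip: term_class_def)
qed

lemmas presented_algebra_simps =
  zero_presented_algebra add_presented_algebra mult_presented_algebra smult_presented_algebra

lemma term_class_axiom:
  assumes "algebra_axiom t u" "t \<in> terms_over X" "u \<in> terms_over X"
  shows "term_class X \<R> t = term_class X \<R> u"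
  using assms by (intro term_class_cong presentation_cong.ax)

lemma term_class_relation:
  assumes "(t, u) \<in> \<R>" "t \<in> terms_over X" "u \<in> terms_over X"
  shows "term_class X \<R> t = term_class X \<R> u"
  using assms by (intro term_class_cong presentation_cong.rel)

theorem semiring_algebra_presented_algebra: "semiring_algebra (presented_algebra X \<R>)"
proof -
  have am: "abelian_monoid (presented_algebra X \<R>)"
    by (rule abelian_monoidI)
      (auto simp: carrier_presented_algebra presented_algebra_simps
        term_class_eq_iff
        intro!: presentation_cong.ax intro: algebra_axiom.intros del: equalityI)
  show ?thesis
    by (intro semiring_algebra.intro hemiring.intro am hemiring_axioms.intro
        semiring_algebra_axioms.intro)
      (auto simp: carrier_presented_algebra presented_algebra_simps
        term_class_eq_iff
        intro!: presentation_cong.ax intro: algebra_axiom.intros del: equalityI)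
qed

primrec eval_term ::
  "('s, 'a, 'm) module_scheme \<Rightarrow> ('x \<Rightarrow> 'a) \<Rightarrow> ('s, 'x) alg_term \<Rightarrow> 'a" where
  "eval_term A \<phi> (TGen x) = \<phi> x"
| "eval_term A \<phi> TZero = \<zero>\<^bsub>A\<^esub>"
| "eval_term A \<phi> (TAdd t u) = eval_term A \<phi> t \<oplus>\<^bsub>A\<^esub> eval_term A \<phi> u"
| "eval_term A \<phi> (TMult t u) = eval_term A \<phi> t \<otimes>\<^bsub>A\<^esub> eval_term A \<phi> u"
| "eval_term A \<phi> (TSmult s t) = s \<odot>\<^bsub>A\<^esub> eval_term A \<phi> t"

context semiring_algebra
begin

lemma eval_term_closed:
  "\<lbrakk>\<And>x. x \<in> X \<Longrightarrow> \<phi> x \<in> carrier A; t \<in> terms_over X\<rbrakk> \<Longrightarrow> eval_term A \<phi> t \<in> carrier A"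
  by (induction t) (auto simp: m_closed smult_closed)

lemma eval_term_axiom:
  assumes "\<And>x. x \<in> X \<Longrightarrow> \<phi> x \<in> carrier A"
    and "algebra_axiom t u" "t \<in> terms_over X" "u \<in> terms_over X"
  shows "eval_term A \<phi> t = eval_term A \<phi> u"
  using assms(2-)
  by (cases rule: algebra_axiom.cases)
    (auto simp: eval_term_closed[OF assms(1)] m_closed smult_closed a_ac m_assoc l_distr r_distr
      l_null r_null smult_r_distr smult_l_distr smult_assoc smult_one smult_l_null smult_r_null
      smult_mult_l smult_mult_r)

text \<open>The universal property of \<open>presented_algebra\<close>.\<close>

theorem presented_algebra_universal:
  assumes \<phi>: "\<And>x. x \<in> X \<Longrightarrow> \<phi> x \<in> carrier A"
    and \<R>: "\<And>t u. \<lbrakk>(t, u) \<in> \<R>; t \<in> terms_over X; u \<in> terms_over X\<rbrakk>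
               \<Longrightarrow> eval_term A \<phi> t = eval_term A \<phi> u"
  shows "\<exists>!h. h \<in> extensional (carrier (presented_algebra X \<R>)) \<and>
           h \<in> carrier (presented_algebra X \<R>) \<rightarrow> carrier A \<and>
           h \<zero>\<^bsub>presented_algebra X \<R>\<^esub> = \<zero> \<and>
           (\<forall>a\<in>carrier (presented_algebra X \<R>). \<forall>b\<in>carrier (presented_algebra X \<R>).
              h (a \<oplus>\<^bsub>presented_algebra X \<R>\<^esub> b) = h a \<oplus> h b \<and>
              h (a \<otimes>\<^bsub>presented_algebra X \<R>\<^esub> b) = h a \<otimes> h b) \<and>
           (\<forall>s. \<forall>a\<in>carrier (presented_algebra X \<R>).
              h (s \<odot>\<^bsub>presented_algebra X \<R>\<^esub> a) = s \<odot> h a) \<and>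
           (\<forall>x\<in>X. h (term_class X \<R> (TGen x)) = \<phi> x)"
    (is "\<exists>!h. ?hom h")
proof -
  let ?P = "presented_algebra X \<R>" and ?c = "term_class X \<R>"
  have sound: "eval_term A \<phi> t = eval_term A \<phi> u" if "(t, u) \<in> presentation_cong X \<R>" for t u
    using that by induction (auto simp: \<R> eval_term_axiom[OF \<phi>])
  define h where "h = restrict (\<lambda>a. eval_term A \<phi> (SOME t. t \<in> a)) (carrier ?P)"
  have h: "h (?c t) = eval_term A \<phi> t" if t: "t \<in> terms_over X" for t
  proof -
    have "t \<in> ?c t" using t by (auto simp: term_class_def intro: presentation_cong.refl)
    then have "(SOME u. u \<in> ?c t) \<in> ?c t" by (rule someI)
    then have "(t, SOME u. u \<in> ?c t) \<in> presentation_cong X \<R>" by (simp only: term_class_def Image_singleton_iff)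
    from sound[OF this] t show ?thesis by (auto simp: h_def carrier_presented_algebra)
  qed
  have "?hom h"
    by (auto simp: carrier_presented_algebra presented_algebra_simps h eval_term_closed[OF \<phi>])
      (simp add: h_def carrier_presented_algebra)
  moreover have "g = h" if g: "?hom g" for g
  proof (rule extensionalityI)
    show "g \<in> extensional (carrier ?P)" using g by blast
    show "h \<in> extensional (carrier ?P)" by (simp add: h_def)
    have "t \<in> terms_over X \<Longrightarrow> g (?c t) = eval_term A \<phi> t" for t
    proof (induction t)
      case (TGen x) then show ?case using g by simp
    next
      case TZero then show ?case using g by (simp add: zero_presented_algebra)
    next
      case (TAdd t u) then show ?case using g
        by (simp add: carrier_presented_algebra flip: add_presented_algebra)
    next
      case (TMult t u) then show ?case using g
        by (simp add: carrier_presented_algebra flip: mult_presented_algebra)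
    next
      case (TSmult s t) then show ?case using g
        by (simp add: carrier_presented_algebra flip: smult_presented_algebra)
    qed
    then show "g a = h a" if "a \<in> carrier ?P" for a
      using that h by (auto simp: carrier_presented_algebra)
  qed
  ultimately show ?thesis by (rule ex1I)
qed

end

lemma leavitt_relations_closed:
  assumes "wf_digraph G" "(t, u) \<in> leavitt_relations G"
  shows "t \<in> terms_over (leavitt_gens G) \<and> u \<in> terms_over (leavitt_gens G)"
proof -
  interpret wf_digraph G by fact
  have sum: "foldr (\<lambda>e. TAdd (TMult (TGen (Edge e)) (TGen (Ghost e)))) es TZero
      \<in> terms_over (leavitt_gens G)" if "set es \<subseteq> arcs G" for es
    using that by (induction es) (auto simp: leavitt_gens_def)
  show ?thesis
    using assms(2)
    by cases (auto simp: leavitt_gens_def regular_vertex_def sum[unfolded leavitt_gens_def] out_arcs_def)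
qed

theorem semiring_algebra_leavitt_path_algebra:
  "semiring_algebra (leavitt_path_algebra TYPE('s::{comm_semiring_0, comm_monoid_mult}) G)"
  unfolding leavitt_path_algebra_def by (rule semiring_algebra_presented_algebra)

end

theory Submission
  imports Defs
begin

text \<open>
  Write \<open>A\<close> for the algebra and let \<open>I \<noteq> 0\<close> be an ideal. It suffices to show that \<open>I\<close> contains every
  vertex, because the vertices are local units for the generators (\<open>ideal_eq_carrier\<close>).
  The Bourne congruence of \<open>I\<close> relates \<open>0\<close> to all of \<open>I\<close>, hence it is the full relation, so every \<open>x\<close>
  satisfies \<open>x + a = b\<close> for some \<open>a, b \<in> I\<close> (\<open>ideal_absorbs\<close>). For the ideal of additively invertible
  elements this shows that either all elements of \<open>A\<close> are invertible, or only \<open>0\<close> is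
  (\<open>ring_or_zerosumfree\<close>). In the first case a vertex \<open>v\<close> with \<open>v + a = b\<close> is \<open>v b + (- v) a \<in> I\<close>.

  In the second case two further congruences show that addition is idempotent and that every scalar
  acts as \<open>0\<close> or as \<open>1\<close> (\<open>scalar_absorbed\<close>, \<open>scalar_zero_or_one\<close>). So \<open>A\<close> is ordered by
  \<open>x \<le> y \<longleftrightarrow> x + y = y\<close>, each element is a finite sum of monomials \<open>p q\<^sup>*\<close> with paths \<open>p, q\<close> of the same
  range, and every \<open>x\<close> lies below an element of \<open>I\<close>. The decisive tool is one more congruence,
  which relates \<open>x\<close> and \<open>y\<close> if \<open>s x t = 0 \<longleftrightarrow> s y t = 0\<close> for all \<open>s, t\<close>. It is not full, so it is
  equality, and it can be tested on ghost paths \<open>s\<close> and paths \<open>t\<close> (\<open>separation\<close>). It has two uses.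

  First, \<open>I\<close> contains a nonzero vertex (\<open>nonzero_vertex_in_ideal\<close>). Start from a nonzero vertex \<open>v\<close>
  and an element \<open>v + b\<^sub>1 + \<dots> + b\<^sub>n\<close> of \<open>I\<close> with monomials \<open>b\<^sub>i\<close> at \<open>v\<close>. A summand below \<open>v\<close> is absorbed.
  For a summand that is not, separation yields a path \<open>\<eta>\<close> with \<open>\<eta>\<^sup>* b\<^sub>i \<eta> = 0\<close> and a nonzero range \<open>w\<close>
  (\<open>conjugate_to_zero\<close>), and conjugation by \<open>\<eta>\<close> gives an element of the same form at \<open>w\<close> with fewer
  summands.

  Second, \<open>I\<close> contains each vertex \<open>w\<close>. The sums of monomials that pass through vertices of \<open>I\<close> form a
  nonzero ideal, so \<open>w\<close> lies below such a sum \<open>y\<close>. If \<open>w \<notin> I\<close>, then the paths in \<open>y\<close> are nontrivial;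
  let \<open>F\<close> be the set of their first edges. Separation shows \<open>w = (\<Sum>e\<in>F. e e\<^sup>*)\<close>
  (\<open>vertex_eq_range_projection\<close>), and the range of each \<open>e \<in> F\<close> lies below \<open>e\<^sup>* y e\<close>, whose paths are
  shorter. By induction on the length these ranges are in \<open>I\<close>, hence so is \<open>w\<close>
  (\<open>vertex_below_short_monomials\<close>).
\<close>


section \<open>Congruence-simple hemirings\<close>

context hemiring
begin

declare m_closed [simp, intro] l_null [simp] r_null [simp]

text \<open>The form in which congruence-simplicity is used, free of the bookkeeping of relations on the
  carrier.\<close>

lemma congruence_dichotomy:
  assumes simple: "congruence_simple R"
    and refl: "\<And>x. x \<in> carrier R \<Longrightarrow> P x x"
    and sym: "\<And>x y. \<lbrakk>x \<in> carrier R; y \<in> carrier R; P x y\<rbrakk> \<Longrightarrow> P y x"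
    and trans: "\<And>x y z. \<lbrakk>x \<in> carrier R; y \<in> carrier R; z \<in> carrier R; P x y; P y z\<rbrakk> \<Longrightarrow> P x z"
    and add: "\<And>x y z. \<lbrakk>x \<in> carrier R; y \<in> carrier R; z \<in> carrier R; P x y\<rbrakk> \<Longrightarrow> P (z \<oplus> x) (z \<oplus> y)"
    and mult_left: "\<And>x y z. \<lbrakk>x \<in> carrier R; y \<in> carrier R; z \<in> carrier R; P x y\<rbrakk>
      \<Longrightarrow> P (z \<otimes> x) (z \<otimes> y)"
    and mult_right: "\<And>x y z. \<lbrakk>x \<in> carrier R; y \<in> carrier R; z \<in> carrier R; P x y\<rbrakk>
      \<Longrightarrow> P (x \<otimes> z) (y \<otimes> z)"
  obtains (diagonal) "\<And>x y. \<lbrakk>x \<in> carrier R; y \<in> carrier R; P x y\<rbrakk> \<Longrightarrow> x = y"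
    | (total) "\<And>x y. \<lbrakk>x \<in> carrier R; y \<in> carrier R\<rbrakk> \<Longrightarrow> P x y"
proof -
  define \<rho> where "\<rho> = {(x, y). x \<in> carrier R \<and> y \<in> carrier R \<and> P x y}"
  have "equiv (carrier R) \<rho>"
    by (intro equivI refl_onI symI transI) (auto simp: \<rho>_def intro: refl sym trans)
  then have "hemiring_congruence R \<rho>"
    by (auto simp: hemiring_congruence_def \<rho>_def add mult_left mult_right)
  with simple consider "\<rho> = Id_on (carrier R)" | "\<rho> = carrier R \<times> carrier R"
    by (auto simp: congruence_simple_def)
  then show ?thesis
  proof cases
    case 1
    show ?thesis
    proof (rule diagonal)
      fix x y assume "x \<in> carrier R" "y \<in> carrier R" "P x y"
      then have "(x, y) \<in> \<rho>" by (simp add: \<rho>_def)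
      with 1 show "x = y" by auto
    qed
  next
    case 2
    show ?thesis
    proof (rule total)
      fix x y assume "x \<in> carrier R" "y \<in> carrier R"
      then have "(x, y) \<in> \<rho>" using 2 by auto
      then show "P x y" by (simp add: \<rho>_def)
    qed
  qed
qed

lemma hemiring_idealI:
  assumes "I \<subseteq> carrier R" "\<zero> \<in> I" "\<And>a b. \<lbrakk>a \<in> I; b \<in> I\<rbrakk> \<Longrightarrow> a \<oplus> b \<in> I"
    and "\<And>a x. \<lbrakk>a \<in> I; x \<in> carrier R\<rbrakk> \<Longrightarrow> x \<otimes> a \<in> I"
    and "\<And>a x. \<lbrakk>a \<in> I; x \<in> carrier R\<rbrakk> \<Longrightarrow> a \<otimes> x \<in> I"
  shows "hemiring_ideal R I"
  using assms by (auto simp: hemiring_ideal_def intro!: submonoid.intro)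

lemma hemiring_idealD:
  assumes "hemiring_ideal R I"
  shows "I \<subseteq> carrier R" "\<zero> \<in> I" "\<And>a b. \<lbrakk>a \<in> I; b \<in> I\<rbrakk> \<Longrightarrow> a \<oplus> b \<in> I"
    and "\<And>a x. \<lbrakk>a \<in> I; x \<in> carrier R\<rbrakk> \<Longrightarrow> x \<otimes> a \<in> I"
    and "\<And>a x. \<lbrakk>a \<in> I; x \<in> carrier R\<rbrakk> \<Longrightarrow> a \<otimes> x \<in> I"
  using assms submonoid.subset submonoid.one_closed submonoid.m_closed
  by (fastforce simp: hemiring_ideal_def)+

text \<open>If \<open>I\<close> is closed under negation, this says \<open>I = R\<close>. In general it only makes \<open>I\<close>
  cofinal, and the gap between the two is what the structure of path algebras has to close.\<close>

lemma ideal_absorbs: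
  assumes simple: "congruence_simple R" and I: "hemiring_ideal R I" "I \<noteq> {\<zero>}"
    and x: "x \<in> carrier R"
  obtains a b where "a \<in> I" "b \<in> I" "x \<oplus> a = b"
proof -
  note I' = hemiring_idealD[OF I(1)]
  have sub: "a \<in> carrier R" if "a \<in> I" for a using that I'(1) by auto
  \<comment> \<open>The Bourne congruence of \<open>I\<close>; it collapses \<open>I\<close> to \<open>0\<close>, so it is not equality.\<close>
  define P where "P x y \<longleftrightarrow> (\<exists>a\<in>I. \<exists>b\<in>I. x \<oplus> a = y \<oplus> b)" for x y
  show ?thesis
  proof (rule congruence_dichotomy[OF simple, of P])
    show "P x x" if "x \<in> carrier R" for x using I'(2) by (auto simp: P_def)
    show "P y x" if "P x y" for x y using that by (metis P_def)
    show "P x z" if xyz: "x \<in> carrier R" "y \<in> carrier R" "z \<in> carrier R" and "P x y" "P y z" for x y z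
    proof -
      from \<open>P x y\<close> \<open>P y z\<close> obtain a b c d where
        *: "a \<in> I" "b \<in> I" "x \<oplus> a = y \<oplus> b" "c \<in> I" "d \<in> I" "y \<oplus> c = z \<oplus> d"
        unfolding P_def by blast
      have "x \<oplus> (a \<oplus> c) = (x \<oplus> a) \<oplus> c" using *(1,2,4,5) xyz sub by (simp add: a_assoc)
      also have "\<dots> = (y \<oplus> b) \<oplus> c" by (simp only: *)
      also have "\<dots> = (y \<oplus> c) \<oplus> b" using *(1,2,4,5) xyz sub by (simp add: a_ac)
      also have "\<dots> = (z \<oplus> d) \<oplus> b" by (simp only: *)
      also have "\<dots> = z \<oplus> (d \<oplus> b)" using *(1,2,4,5) xyz sub by (simp add: a_assoc)
      finally show ?thesis using * I'(3) unfolding P_def by blast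
    qed
    show "P (z \<oplus> x) (z \<oplus> y)" if xyz: "x \<in> carrier R" "y \<in> carrier R" "z \<in> carrier R" and "P x y" for x y z
    proof -
      from \<open>P x y\<close> obtain a b where *: "a \<in> I" "b \<in> I" "x \<oplus> a = y \<oplus> b" unfolding P_def by blast
      then have "(z \<oplus> x) \<oplus> a = (z \<oplus> y) \<oplus> b" using xyz sub by (simp add: a_assoc)
      with * show ?thesis unfolding P_def by blast
    qed
    show "P (z \<otimes> x) (z \<otimes> y)" if xyz: "x \<in> carrier R" "y \<in> carrier R" "z \<in> carrier R" and "P x y" for x y z
    proof -
      from \<open>P x y\<close> obtain a b where *: "a \<in> I" "b \<in> I" "x \<oplus> a = y \<oplus> b" unfolding P_def by blast
      then have "z \<otimes> x \<oplus> z \<otimes> a = z \<otimes> y \<oplus> z \<otimes> b" using xyz sub by (simp flip: r_distr)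
      with * I'(4) xyz show ?thesis unfolding P_def by blast
    qed
    show "P (x \<otimes> z) (y \<otimes> z)" if xyz: "x \<in> carrier R" "y \<in> carrier R" "z \<in> carrier R" and "P x y" for x y z
    proof -
      from \<open>P x y\<close> obtain a b where *: "a \<in> I" "b \<in> I" "x \<oplus> a = y \<oplus> b" unfolding P_def by blast
      then have "x \<otimes> z \<oplus> a \<otimes> z = y \<otimes> z \<oplus> b \<otimes> z" using xyz sub by (simp flip: l_distr)
      with * I'(5) xyz show ?thesis unfolding P_def by blast
    qed
  next
    assume diag: "\<And>x y. \<lbrakk>x \<in> carrier R; y \<in> carrier R; P x y\<rbrakk> \<Longrightarrow> x = y"
    have "a = \<zero>" if "a \<in> I" for a
    proof (rule diag)
      have "a \<oplus> \<zero> = \<zero> \<oplus> a" using that sub by simp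
      then show "P a \<zero>" using that I'(2) unfolding P_def by blast
    qed (use that sub in auto)
    with I'(2) have "I = {\<zero>}" by blast
    with I(2) show ?thesis by contradiction
  next
    assume "\<And>x y. \<lbrakk>x \<in> carrier R; y \<in> carrier R\<rbrakk> \<Longrightarrow> P x y"
    with x have "P x \<zero>" by simp
    then obtain a b where ab: "a \<in> I" "b \<in> I" "x \<oplus> a = \<zero> \<oplus> b" unfolding P_def by blast
    with sub have "x \<oplus> a = b" by simp
    with ab show ?thesis using that by blast
  qed
qed

lemma ring_or_zerosumfree:
  assumes simple: "congruence_simple R"
  obtains (ring) "\<And>x. x \<in> carrier R \<Longrightarrow> \<exists>y\<in>carrier R. x \<oplus> y = \<zero>"
    | (zerosumfree) "\<And>x y. \<lbrakk>x \<in> carrier R; y \<in> carrier R; x \<oplus> y = \<zero>\<rbrakk> \<Longrightarrow> x = \<zero>"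
proof -
  define N where "N = {x \<in> carrier R. \<exists>y\<in>carrier R. x \<oplus> y = \<zero>}"
  have N: "hemiring_ideal R N"
  proof (rule hemiring_idealI)
    show "N \<subseteq> carrier R" "\<zero> \<in> N" by (auto simp: N_def)
    show "a \<oplus> b \<in> N" if ab: "a \<in> N" "b \<in> N" for a b
    proof -
      from ab obtain c d where "a \<in> carrier R" "b \<in> carrier R" "c \<in> carrier R" "d \<in> carrier R"
        "a \<oplus> c = \<zero>" "b \<oplus> d = \<zero>" by (auto simp: N_def)
      moreover from this have "(a \<oplus> b) \<oplus> (c \<oplus> d) = (a \<oplus> c) \<oplus> (b \<oplus> d)" by (simp add: a_ac)
      ultimately show ?thesis by (auto simp: N_def intro!: bexI[of _ "c \<oplus> d"])
    qed
    show "x \<otimes> a \<in> N" if a: "a \<in> N" and x: "x \<in> carrier R" for a x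
    proof -
      from a obtain c where "a \<in> carrier R" "c \<in> carrier R" "a \<oplus> c = \<zero>" by (auto simp: N_def)
      with x show ?thesis by (auto simp: N_def intro!: bexI[of _ "x \<otimes> c"] simp flip: r_distr)
    qed
    show "a \<otimes> x \<in> N" if a: "a \<in> N" and x: "x \<in> carrier R" for a x
    proof -
      from a obtain c where "a \<in> carrier R" "c \<in> carrier R" "a \<oplus> c = \<zero>" by (auto simp: N_def)
      with x show ?thesis by (auto simp: N_def intro!: bexI[of _ "c \<otimes> x"] simp flip: l_distr)
    qed
  qed
  show ?thesis
  proof (cases "N = {\<zero>}")
    case True
    then show ?thesis by (intro zerosumfree) (auto simp: N_def)
  next
    case False
    show ?thesis
    proof (rule ring)
      fix x assume x: "x \<in> carrier R"
      obtain a b where ab: "a \<in> N" "b \<in> N" "x \<oplus> a = b" by (rule ideal_absorbs[OF simple N False x])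
      then obtain d where d: "a \<in> carrier R" "d \<in> carrier R" "b \<oplus> d = \<zero>" by (auto simp: N_def)
      then have "x \<oplus> (a \<oplus> d) = \<zero>" using ab x by (simp flip: a_assoc)
      with d show "\<exists>y\<in>carrier R. x \<oplus> y = \<zero>" by (intro bexI[of _ "a \<oplus> d"]) auto
    qed
  qed
qed

end


section \<open>Scalars of congruence-simple algebras\<close>

context semiring_algebra
begin

declare smult_closed [simp, intro] smult_r_null [simp] smult_one [simp] smult_l_null [simp]

text \<open>
  Two elements are related if each is a summand of a scalar multiple of the other. Only \<open>0\<close> is related
  to \<open>0\<close>, so this congruence is equality, but it relates \<open>x\<close> to \<open>(1 + s) x\<close>. The case \<open>s = 1\<close> says that
  addition is idempotent.
\<close>

lemma scalar_absorbed:
  assumes simple: "congruence_simple A"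
    and zerosumfree: "\<And>x y. \<lbrakk>x \<in> carrier A; y \<in> carrier A; x \<oplus> y = \<zero>\<rbrakk> \<Longrightarrow> x = \<zero>"
    and x: "x \<in> carrier A"
  shows "x \<oplus> s \<odot> x = x"
proof -
  define L where "L x y \<longleftrightarrow> (\<exists>t. \<exists>z\<in>carrier A. x \<oplus> z = t \<odot> y)" for x y
  have L_add: "L (c \<oplus> x) (c \<oplus> y)"
    if "x \<in> carrier A" "y \<in> carrier A" "c \<in> carrier A" and L: "L x y" for x y c
  proof -
    from L obtain t z where z: "z \<in> carrier A" "x \<oplus> z = t \<odot> y" unfolding L_def by blast
    \<comment> \<open>The coefficient \<open>1 + t\<close> leaves room for the summand \<open>c\<close>.\<close>
    have "(1 + t) \<odot> (c \<oplus> y) = (c \<oplus> t \<odot> y) \<oplus> (t \<odot> c \<oplus> y)"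
      using that by (simp add: smult_l_distr smult_r_distr a_ac)
    also have "\<dots> = (c \<oplus> x) \<oplus> (z \<oplus> (t \<odot> c \<oplus> y))"
      using that z by (simp add: a_assoc flip: z(2))
    finally show ?thesis using that z unfolding L_def by (metis a_closed smult_closed)
  qed
  have L_trans: "L x w"
    if "x \<in> carrier A" "y \<in> carrier A" "w \<in> carrier A" and L: "L x y" "L y w" for x y w
  proof -
    from L obtain t z t' z' where z: "z \<in> carrier A" "x \<oplus> z = t \<odot> y" "z' \<in> carrier A" "y \<oplus> z' = t' \<odot> w"
      unfolding L_def by blast
    have "(t * t') \<odot> w = t \<odot> y \<oplus> t \<odot> z'"
      using that z by (simp add: smult_assoc flip: z(4)) (simp add: smult_r_distr)
    also have "\<dots> = x \<oplus> (z \<oplus> t \<odot> z')" using that z by (simp add: a_assoc flip: z(2))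
    finally show ?thesis using that z unfolding L_def by (metis a_closed smult_closed)
  qed
  have L_left: "L (c \<otimes> x) (c \<otimes> y)"
    if "x \<in> carrier A" "y \<in> carrier A" "c \<in> carrier A" and L: "L x y" for x y c
  proof -
    from L obtain t z where z: "z \<in> carrier A" "x \<oplus> z = t \<odot> y" unfolding L_def by blast
    then have "c \<otimes> x \<oplus> c \<otimes> z = t \<odot> (c \<otimes> y)" using that by (simp add: smult_mult_r flip: r_distr)
    then show ?thesis using that z unfolding L_def by blast
  qed
  have L_right: "L (x \<otimes> c) (y \<otimes> c)"
    if "x \<in> carrier A" "y \<in> carrier A" "c \<in> carrier A" and L: "L x y" for x y c
  proof -
    from L obtain t z where z: "z \<in> carrier A" "x \<oplus> z = t \<odot> y" unfolding L_def by blast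
    then have "x \<otimes> c \<oplus> z \<otimes> c = t \<odot> (y \<otimes> c)" using that by (simp add: smult_mult_l flip: l_distr)
    then show ?thesis using that z unfolding L_def by blast
  qed
  have L_refl: "L x x" if "x \<in> carrier A" for x
    unfolding L_def using that by (intro exI[of _ 1] bexI[of _ \<zero>]) auto
  have L_zero: "x = \<zero>" if "x \<in> carrier A" "L x \<zero>" for x
  proof -
    from that obtain t z where "z \<in> carrier A" "x \<oplus> z = t \<odot> \<zero>" unfolding L_def by blast
    then show ?thesis using zerosumfree[OF that(1), of z] by simp
  qed
  let ?P = "\<lambda>x y. L x y \<and> L y x"
  show ?thesis
  proof (rule congruence_dichotomy[OF simple, of ?P])
    assume diag: "\<And>x y. \<lbrakk>x \<in> carrier A; y \<in> carrier A; L x y \<and> L y x\<rbrakk> \<Longrightarrow> x = y"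
    have "L x (x \<oplus> s \<odot> x)" unfolding L_def using x by (intro exI[of _ 1] bexI[of _ "s \<odot> x"]) auto
    moreover have "L (x \<oplus> s \<odot> x) x" unfolding L_def using x
      by (intro exI[of _ "1 + s"] bexI[of _ \<zero>]) (auto simp: smult_l_distr)
    ultimately show ?thesis using x by (intro diag) auto
  next
    assume total: "\<And>x y. \<lbrakk>x \<in> carrier A; y \<in> carrier A\<rbrakk> \<Longrightarrow> L x y \<and> L y x"
    have "y = \<zero>" if "y \<in> carrier A" for y using L_zero[OF that] total[OF that zero_closed] by blast
    then show ?thesis using x by (metis a_closed smult_closed)
  next
    fix x y w assume "x \<in> carrier A" "y \<in> carrier A" "w \<in> carrier A"
      "L x y \<and> L y x" "L y w \<and> L w y"
    then show "L x w \<and> L w x" using L_trans[of x y w] L_trans[of w y x] by simp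
  qed (simp_all add: L_add L_left L_right L_refl)
qed

lemma scalar_kernel_dichotomy:
  assumes simple: "congruence_simple A"
  obtains (zero) "\<And>x. x \<in> carrier A \<Longrightarrow> s \<odot> x = \<zero>"
    | (inj) "inj_on ((\<odot>) s) (carrier A)"
proof (rule congruence_dichotomy[OF simple, of "\<lambda>x y. s \<odot> x = s \<odot> y"])
  assume "\<And>x y. \<lbrakk>x \<in> carrier A; y \<in> carrier A; s \<odot> x = s \<odot> y\<rbrakk> \<Longrightarrow> x = y"
  then show ?thesis by (intro inj inj_onI)
next
  assume *: "\<And>x y. \<lbrakk>x \<in> carrier A; y \<in> carrier A\<rbrakk> \<Longrightarrow> s \<odot> x = s \<odot> y"
  have "s \<odot> x = \<zero>" if "x \<in> carrier A" for x using *[OF that zero_closed] by simp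
  then show ?thesis by (rule zero)
next
  fix x y z assume "x \<in> carrier A" "y \<in> carrier A" "z \<in> carrier A" "s \<odot> x = s \<odot> y"
  then show "s \<odot> (x \<otimes> z) = s \<odot> (y \<otimes> z)" by (simp flip: smult_mult_l)
qed (simp_all add: smult_r_distr flip: smult_mult_r)

text \<open>
  If \<open>s\<close> does not act as \<open>0\<close>, then it acts injectively. In the natural order of the idempotent addition,
  relate two elements if each dominates some \<open>s ^ n\<close> multiple of the other. Injectivity keeps \<open>0\<close>
  isolated, so this congruence is equality, but it relates \<open>x\<close> to \<open>s x\<close>.
\<close>

lemma scalar_zero_or_one:
  assumes simple: "congruence_simple A"
    and zerosumfree: "\<And>x y. \<lbrakk>x \<in> carrier A; y \<in> carrier A; x \<oplus> y = \<zero>\<rbrakk> \<Longrightarrow> x = \<zero>"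
  obtains (zero) "\<And>x. x \<in> carrier A \<Longrightarrow> s \<odot> x = \<zero>"
    | (one) "\<And>x. x \<in> carrier A \<Longrightarrow> s \<odot> x = x"
proof (rule scalar_kernel_dichotomy[OF simple, of s])
  assume inj: "inj_on ((\<odot>) s) (carrier A)"
  have absorb: "x \<oplus> t \<odot> x = x" if "x \<in> carrier A" for x t
    using scalar_absorbed[OF simple _ that] zerosumfree by blast
  have idem: "x \<oplus> x = x" if "x \<in> carrier A" for x using absorb[OF that, of 1] that by simp
  define L where "L x y \<longleftrightarrow> (\<exists>n. s ^ n \<odot> x \<oplus> y = y)" for x y
  have pow: "s ^ n \<odot> x \<oplus> x = x" if "x \<in> carrier A" for n x
    using absorb[OF that] that by (simp add: a_comm)
  have L_zero: "x = \<zero>" if x: "x \<in> carrier A" and L: "L x \<zero>" for x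
  proof -
    from L x obtain n where "s ^ n \<odot> x = \<zero>" unfolding L_def by auto
    then show ?thesis
    proof (induction n)
      case (Suc n)
      then have "s \<odot> (s ^ n \<odot> x) = s \<odot> \<zero>" using x by (simp flip: smult_assoc)
      then show ?case using Suc.IH inj_onD[OF inj] x by blast
    qed (use x in simp)
  qed
  have mono: "s ^ n \<odot> u \<oplus> s ^ n \<odot> v = s ^ n \<odot> v" if "u \<in> carrier A" "v \<in> carrier A" "u \<oplus> v = v" for n u v
    using that by (simp flip: smult_r_distr)
  have L_trans: "L x w"
    if "x \<in> carrier A" "y \<in> carrier A" "w \<in> carrier A" and L: "L x y" "L y w" for x y w
  proof -
    from L obtain m n where mn: "s ^ m \<odot> x \<oplus> y = y" "s ^ n \<odot> y \<oplus> w = w" unfolding L_def by blast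
    have "s ^ n \<odot> (s ^ m \<odot> x) \<oplus> w = s ^ n \<odot> (s ^ m \<odot> x) \<oplus> (s ^ n \<odot> y \<oplus> w)" by (simp add: mn)
    also have "\<dots> = (s ^ n \<odot> (s ^ m \<odot> x) \<oplus> s ^ n \<odot> y) \<oplus> w" using that by (simp add: a_assoc)
    also have "\<dots> = w" using that by (simp add: mono mn)
    finally have "s ^ (n + m) \<odot> x \<oplus> w = w" using that by (simp add: smult_assoc power_add)
    then show ?thesis unfolding L_def ..
  qed
  have L_add: "L (c \<oplus> x) (c \<oplus> y)"
    if "x \<in> carrier A" "y \<in> carrier A" "c \<in> carrier A" and L: "L x y" for x y c
  proof -
    from L obtain n where n: "s ^ n \<odot> x \<oplus> y = y" unfolding L_def by blast
    have "s ^ n \<odot> (c \<oplus> x) \<oplus> (c \<oplus> y) = (s ^ n \<odot> c \<oplus> c) \<oplus> (s ^ n \<odot> x \<oplus> y)"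
      using that by (simp add: smult_r_distr a_ac)
    then have "s ^ n \<odot> (c \<oplus> x) \<oplus> (c \<oplus> y) = c \<oplus> y" using that by (simp add: pow n)
    then show ?thesis unfolding L_def by blast
  qed
  have L_left: "L (c \<otimes> x) (c \<otimes> y)"
    if "x \<in> carrier A" "y \<in> carrier A" "c \<in> carrier A" and L: "L x y" for x y c
  proof -
    from L obtain n where n: "s ^ n \<odot> x \<oplus> y = y" unfolding L_def by blast
    then have "s ^ n \<odot> (c \<otimes> x) \<oplus> c \<otimes> y = c \<otimes> y" using that by (simp flip: smult_mult_r r_distr)
    then show ?thesis unfolding L_def by blast
  qed
  have L_right: "L (x \<otimes> c) (y \<otimes> c)"
    if "x \<in> carrier A" "y \<in> carrier A" "c \<in> carrier A" and L: "L x y" for x y c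
  proof -
    from L obtain n where n: "s ^ n \<odot> x \<oplus> y = y" unfolding L_def by blast
    then have "s ^ n \<odot> (x \<otimes> c) \<oplus> y \<otimes> c = y \<otimes> c" using that by (simp flip: smult_mult_l l_distr)
    then show ?thesis unfolding L_def by blast
  qed
  have L_refl: "L x x" if "x \<in> carrier A" for x
    unfolding L_def using that by (intro exI[of _ 0]) (simp add: idem)
  show ?thesis
  proof (rule congruence_dichotomy[OF simple, of "\<lambda>x y. L x y \<and> L y x"])
    assume diag: "\<And>x y. \<lbrakk>x \<in> carrier A; y \<in> carrier A; L x y \<and> L y x\<rbrakk> \<Longrightarrow> x = y"
    show ?thesis
    proof (rule one)
      fix x assume x: "x \<in> carrier A"
      have "s ^ 1 \<odot> x \<oplus> s \<odot> x = s \<odot> x" "s ^ 1 \<odot> (s \<odot> x) \<oplus> x = x"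
        using x pow[OF x, of 2] by (simp_all add: idem smult_assoc power2_eq_square)
      then have "L x (s \<odot> x)" "L (s \<odot> x) x" unfolding L_def by blast+
      with x show "s \<odot> x = x" by (intro diag) auto
    qed
  next
    assume total: "\<And>x y. \<lbrakk>x \<in> carrier A; y \<in> carrier A\<rbrakk> \<Longrightarrow> L x y \<and> L y x"
    have "y = \<zero>" if "y \<in> carrier A" for y using L_zero[OF that] total[OF that zero_closed] by blast
    then show ?thesis using zero by (metis smult_closed)
  next
    fix x y w assume "x \<in> carrier A" "y \<in> carrier A" "w \<in> carrier A"
      "L x y \<and> L y x" "L y w \<and> L w y"
    then show "L x w \<and> L w x" using L_trans[of x y w] L_trans[of w y x] by simp
  qed (simp_all add: L_add L_left L_right L_refl)
qed (rule zero)

end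


section \<open>Finite sums\<close>

context hemiring
begin

text \<open>The submonoid generated by \<open>M\<close>, presented so that induction removes one summand at a time.\<close>

inductive_set finite_sums :: "'a set \<Rightarrow> 'a set" for M where
  zero: "\<zero> \<in> finite_sums M"
| add: "\<lbrakk>m \<in> M; y \<in> finite_sums M\<rbrakk> \<Longrightarrow> m \<oplus> y \<in> finite_sums M"

lemma finite_sums_mono: "y \<in> finite_sums M \<Longrightarrow> M \<subseteq> N \<Longrightarrow> y \<in> finite_sums N"
  by (induction rule: finite_sums.induct) (auto intro: finite_sums.intros)

lemma finite_sums_closed: "y \<in> finite_sums M \<Longrightarrow> M \<subseteq> carrier R \<Longrightarrow> y \<in> carrier R"
  by (induction rule: finite_sums.induct) auto

lemma finite_sums_summand: "m \<in> M \<Longrightarrow> M \<subseteq> carrier R \<Longrightarrow> m \<in> finite_sums M"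
  using finite_sums.add[of m M \<zero>] finite_sums.zero by auto

lemma finite_sums_add:
  assumes "x \<in> finite_sums M" "y \<in> finite_sums M" "M \<subseteq> carrier R"
  shows "x \<oplus> y \<in> finite_sums M"
  using assms
proof (induction rule: finite_sums.induct)
  case zero
  then show ?case by (simp add: finite_sums_closed)
next
  case (add m x)
  then show ?case by (auto simp: a_assoc subset_iff finite_sums_closed intro: finite_sums.intros)
qed

lemma finite_sums_conjugate:
  assumes "y \<in> finite_sums M" "M \<subseteq> carrier R" "c \<in> carrier R" "d \<in> carrier R" "N \<subseteq> carrier R"
    and "\<And>m. m \<in> M \<Longrightarrow> c \<otimes> m \<otimes> d \<in> finite_sums N"
  shows "c \<otimes> y \<otimes> d \<in> finite_sums N"
  using assms(1)
proof (induction rule: finite_sums.induct)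
  case zero
  then show ?case using assms by (simp add: finite_sums.zero)
next
  case (add m y)
  then have "c \<otimes> (m \<oplus> y) \<otimes> d = c \<otimes> m \<otimes> d \<oplus> c \<otimes> y \<otimes> d"
    using assms finite_sums_closed[OF add(2)] by (simp add: subset_iff r_distr l_distr)
  then show ?case using add assms by (simp add: finite_sums_add)
qed

lemma finite_sums_mult:
  assumes "x \<in> finite_sums M" "y \<in> finite_sums N" "M \<subseteq> carrier R" "N \<subseteq> carrier R" "K \<subseteq> carrier R"
    and "\<And>m n. \<lbrakk>m \<in> M; n \<in> N\<rbrakk> \<Longrightarrow> m \<otimes> n \<in> finite_sums K"
  shows "x \<otimes> y \<in> finite_sums K"
proof -
  have y: "y \<in> carrier R" using assms by (simp add: finite_sums_closed)
  have *: "m \<otimes> y \<in> finite_sums K" if m: "m \<in> M" for m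
    using assms(2)
  proof (induction rule: finite_sums.induct)
    case zero
    then show ?case using assms m by (auto simp: finite_sums.zero)
  next
    case (add n y)
    then have "m \<otimes> (n \<oplus> y) = m \<otimes> n \<oplus> m \<otimes> y"
      using assms m finite_sums_closed[OF add(2)] by (simp add: subset_iff r_distr)
    then show ?case using add assms m by (simp add: finite_sums_add)
  qed
  from assms(1) show ?thesis
  proof (induction rule: finite_sums.induct)
    case zero
    then show ?case using y by (simp add: finite_sums.zero)
  next
    case (add m x)
    then have "(m \<oplus> x) \<otimes> y = m \<otimes> y \<oplus> x \<otimes> y"
      using assms y finite_sums_closed[OF add(2)] by (simp add: subset_iff l_distr)
    then show ?case using add assms * by (simp add: finite_sums_add)
  qed
qed

end


section \<open>Paths in algebras generated by a graph\<close>

text \<open>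
  An algebra generated by vertices, edges and ghost edges that multiply as in a path algebra. Both Cohn
  and Leavitt path algebras are of this kind; which vertices are finite sums of elements \<open>e e\<^sup>*\<close> will be
  read off from congruence-simplicity.
\<close>

locale path_algebra = semiring_algebra A + wf_digraph G
  for A :: "('s::{comm_semiring_0, comm_monoid_mult}, 'a, 'm) module_scheme" (structure)
    and G :: "('v, 'e) pre_digraph" +
  fixes V :: "'v \<Rightarrow> 'a" and E E' :: "'e \<Rightarrow> 'a"
  assumes V_closed [simp, intro]: "v \<in> verts G \<Longrightarrow> V v \<in> carrier A"
    and E_closed [simp, intro]: "e \<in> arcs G \<Longrightarrow> E e \<in> carrier A"
    and E'_closed [simp, intro]: "e \<in> arcs G \<Longrightarrow> E' e \<in> carrier A"
    and V_V: "\<lbrakk>v \<in> verts G; w \<in> verts G\<rbrakk> \<Longrightarrow> V v \<otimes> V w = (if v = w then V v else \<zero>)"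
    and V_E: "e \<in> arcs G \<Longrightarrow> V (tail G e) \<otimes> E e = E e"
    and E_V: "e \<in> arcs G \<Longrightarrow> E e \<otimes> V (head G e) = E e"
    and V_E': "e \<in> arcs G \<Longrightarrow> V (head G e) \<otimes> E' e = E' e"
    and E'_V: "e \<in> arcs G \<Longrightarrow> E' e \<otimes> V (tail G e) = E' e"
    and E'_E: "\<lbrakk>e \<in> arcs G; f \<in> arcs G\<rbrakk> \<Longrightarrow> E' e \<otimes> E f = (if e = f then V (head G e) else \<zero>)"
    and generated: "\<lbrakk>\<And>v. v \<in> verts G \<Longrightarrow> V v \<in> B; \<And>e. e \<in> arcs G \<Longrightarrow> E e \<in> B;
        \<And>e. e \<in> arcs G \<Longrightarrow> E' e \<in> B; \<zero> \<in> B; \<And>x y. \<lbrakk>x \<in> B; y \<in> B\<rbrakk> \<Longrightarrow> x \<oplus> y \<in> B;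
        \<And>x y. \<lbrakk>x \<in> B; y \<in> B\<rbrakk> \<Longrightarrow> x \<otimes> y \<in> B; \<And>s x. x \<in> B \<Longrightarrow> s \<odot> x \<in> B\<rbrakk> \<Longrightarrow> carrier A \<subseteq> B"
begin

text \<open>
  In \<open>path n v w p p'\<close> the elements \<open>p\<close> and \<open>p'\<close> of the algebra are a path of length \<open>n\<close> from \<open>v\<close> to \<open>w\<close>
  and its ghost. The two are carried along together because the involution of a path algebra is not
  part of the structure here.
\<close>

inductive path :: "nat \<Rightarrow> 'v \<Rightarrow> 'v \<Rightarrow> 'a \<Rightarrow> 'a \<Rightarrow> bool" where
  trivial: "v \<in> verts G \<Longrightarrow> path 0 v v (V v) (V v)"
| cons: "\<lbrakk>e \<in> arcs G; path n (head G e) w p p'\<rbrakk>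
    \<Longrightarrow> path (Suc n) (tail G e) w (E e \<otimes> p) (p' \<otimes> E' e)"

lemma path_closed:
  assumes "path n v w p p'"
  shows "v \<in> verts G" "w \<in> verts G" "p \<in> carrier A" "p' \<in> carrier A"
  using assms by (induction rule: path.induct) auto

lemma path_ends:
  assumes "path n v w p p'"
  shows "V v \<otimes> p = p" "p' \<otimes> V v = p'" "p \<otimes> V w = p" "V w \<otimes> p' = p'"
proof -
  have "V v \<otimes> p = p \<and> p' \<otimes> V v = p' \<and> p \<otimes> V w = p \<and> V w \<otimes> p' = p'"
    using assms
  proof (induction rule: path.induct)
    case (cons e n w p p')
    note closed = path_closed[OF cons(2)]
    have "V (tail G e) \<otimes> (E e \<otimes> p) = (V (tail G e) \<otimes> E e) \<otimes> p"
      and "(p' \<otimes> E' e) \<otimes> V (tail G e) = p' \<otimes> (E' e \<otimes> V (tail G e))"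
      and "(E e \<otimes> p) \<otimes> V w = E e \<otimes> (p \<otimes> V w)" and "V w \<otimes> (p' \<otimes> E' e) = (V w \<otimes> p') \<otimes> E' e"
      using closed cons(1) by (simp_all add: m_assoc)
    with cons show ?case by (simp add: V_E E'_V)
  qed (auto simp: V_V)
  then show "V v \<otimes> p = p" "p' \<otimes> V v = p'" "p \<otimes> V w = p" "V w \<otimes> p' = p'" by auto
qed

lemma V_path: "u \<in> verts G \<Longrightarrow> path n v w p p' \<Longrightarrow> V u \<otimes> p = (if u = v then p else \<zero>)"
  using path_ends(1)[of n v w p p'] V_V[of u v] path_closed[of n v w p p'] m_assoc[of "V u" "V v" p]
  by (auto split: if_splits)

lemma path_V: "u \<in> verts G \<Longrightarrow> path n v w p p' \<Longrightarrow> p' \<otimes> V u = (if u = v then p' else \<zero>)"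
  using path_ends(2)[of n v w p p'] V_V[of v u] path_closed[of n v w p p'] m_assoc[of p' "V v" "V u"]
  by (auto split: if_splits)

lemma E'_E_cancel:
  assumes "e \<in> arcs G" "f \<in> arcs G" "x \<in> carrier A" "y \<in> carrier A"
  shows "(x \<otimes> E' e) \<otimes> (E f \<otimes> y) = (if e = f then x \<otimes> (V (head G e) \<otimes> y) else \<zero>)"
proof -
  have "(x \<otimes> E' e) \<otimes> (E f \<otimes> y) = x \<otimes> ((E' e \<otimes> E f) \<otimes> y)" using assms by (simp add: m_assoc)
  then show ?thesis using assms by (auto simp: E'_E)
qed

lemma path_append:
  assumes "path m v w p p'" "path n w x q q'"
  shows "path (m + n) v x (p \<otimes> q) (q' \<otimes> p')"
  using assms
proof (induction rule: path.induct)
  case (trivial v)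
  then show ?case by (simp add: path_ends[OF trivial(2)])
next
  case (cons e m w p p')
  then have "path (Suc (m + n)) (tail G e) x (E e \<otimes> (p \<otimes> q)) ((q' \<otimes> p') \<otimes> E' e)"
    by (intro path.cons) auto
  then show ?case using cons path_closed[OF cons(2)] path_closed[OF cons(4)] by (simp add: m_assoc)
qed

lemma path_ghost_path: "path n v w p p' \<Longrightarrow> p' \<otimes> p = V w"
proof (induction rule: path.induct)
  case (cons e n w p p')
  then show ?case using path_closed[OF cons(2)] path_ends[OF cons(2)] by (simp add: E'_E_cancel)
qed (simp add: V_V)

text \<open>
  Two paths with the same source either part at some edge, and then annihilate each other, or one
  extends the other.
\<close>

lemma path_compare:
  assumes "path m v w p p'" "path n v x q q'"
  obtains (incomparable) "p' \<otimes> q = \<zero>" "q' \<otimes> p = \<zero>"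
    | (left) k r r' where "path k w x r r'" "q = p \<otimes> r" "q' = r' \<otimes> p'" "p' \<otimes> q = r" "q' \<otimes> p = r'"
    | (right) k r r' where "path k x w r r'" "p = q \<otimes> r" "p' = r' \<otimes> q'" "p' \<otimes> q = r'" "q' \<otimes> p = r"
proof -
  have "(p' \<otimes> q = \<zero> \<and> q' \<otimes> p = \<zero>) \<or>
    (\<exists>k r r'. path k w x r r' \<and> q = p \<otimes> r \<and> q' = r' \<otimes> p' \<and> p' \<otimes> q = r \<and> q' \<otimes> p = r') \<or>
    (\<exists>k r r'. path k x w r r' \<and> p = q \<otimes> r \<and> p' = r' \<otimes> q' \<and> p' \<otimes> q = r' \<and> q' \<otimes> p = r)"
    using assms
  proof (induction arbitrary: n q q' rule: path.induct)
    case (trivial v)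
    then show ?case using path_ends[OF trivial(2)] by metis
  next
    case (cons e m w p p')
    note p = path_closed[OF cons(2)]
    have P: "path (Suc m) (tail G e) w (E e \<otimes> p) (p' \<otimes> E' e)" using cons by (simp add: path.cons)
    from cons(4) show ?case
    proof (cases rule: path.cases)
      case trivial
      then show ?thesis using P path_ends[OF P] by metis
    next
      case (cons f l q1 q1')
      note q = path_closed[OF cons(6)]
      show ?thesis
      proof (cases "e = f")
        case False
        then show ?thesis using cons \<open>e \<in> arcs G\<close> p q by (simp add: E'_E_cancel)
      next
        case True
        have eqs: "(p' \<otimes> E' e) \<otimes> q = p' \<otimes> q1" "q' \<otimes> (E e \<otimes> p) = q1' \<otimes> p"
          using True cons p q path_ends[OF cons(6)] path_ends[OF \<open>path m (head G e) w p p'\<close>]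
          by (simp_all add: E'_E_cancel)
        have "path l (head G e) x q1 q1'" using cons True by simp
        from local.cons.IH[OF this] show ?thesis
        proof (elim disjE exE conjE)
          fix k r r' assume r: "path k w x r r'" "q1 = p \<otimes> r" "q1' = r' \<otimes> p'" "p' \<otimes> q1 = r" "q1' \<otimes> p = r'"
          then have "q = (E e \<otimes> p) \<otimes> r" "q' = r' \<otimes> (p' \<otimes> E' e)"
            using True local.cons p path_closed[OF r(1)] by (simp_all add: m_assoc)
          with r eqs show ?thesis by metis
        next
          fix k r r' assume r: "path k x w r r'" "p = q1 \<otimes> r" "p' = r' \<otimes> q1'" "p' \<otimes> q1 = r'" "q1' \<otimes> p = r"
          then have "E e \<otimes> p = q \<otimes> r" "p' \<otimes> E' e = r' \<otimes> q'"
            using True local.cons p q path_closed[OF r(1)] \<open>e \<in> arcs G\<close> by (simp_all add: m_assoc)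
          with r eqs show ?thesis by metis
        qed (use eqs in simp)
      qed
    qed
  qed
  then show ?thesis using that by blast
qed

end

section \<open>Monomials\<close>

context path_algebra
begin

text \<open>Closed under passing to the ends of paths; vertex sets of ideals have this property.\<close>

definition hereditary :: "'v set \<Rightarrow> bool" where
  "hereditary X \<longleftrightarrow> X \<subseteq> verts G \<and> (\<forall>k x y r r'. x \<in> X \<longrightarrow> path k x y r r' \<longrightarrow> y \<in> X)"

text \<open>The elements \<open>p q\<^sup>*\<close> for paths \<open>p\<close> from \<open>u\<close> and \<open>q\<close> from \<open>v\<close> with a common range in \<open>X\<close>.\<close>

definition monomials :: "'v set \<Rightarrow> 'v \<Rightarrow> 'v \<Rightarrow> 'a set" where
  "monomials X u v = {p \<otimes> q' | k l x p p' q q'. x \<in> X \<and> path k u x p p' \<and> path l v x q q'}"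

lemma monomialsI: "\<lbrakk>x \<in> X; path k u x p p'; path l v x q q'\<rbrakk> \<Longrightarrow> p \<otimes> q' \<in> monomials X u v"
  unfolding monomials_def by blast

lemma monomialsE:
  assumes "m \<in> monomials X u v"
  obtains k l x p p' q q' where "x \<in> X" "path k u x p p'" "path l v x q q'" "m = p \<otimes> q'"
  using assms unfolding monomials_def by blast

lemma monomials_closed: "monomials X u v \<subseteq> carrier A"
  by (auto elim!: monomialsE dest: path_closed)

lemma hereditary_verts: "hereditary (verts G)"
  by (auto simp: hereditary_def dest: path_closed)

lemma monomials_V:
  assumes "m \<in> monomials X u v" "w \<in> verts G"
  shows "V w \<otimes> m = (if w = u then m else \<zero>)" "m \<otimes> V w = (if w = v then m else \<zero>)"
  using assms
  by (auto elim!: monomialsE simp: V_path path_V path_closed m_assoc)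
    (auto simp: V_path path_closed simp flip: m_assoc)

lemma path_monomial:
  assumes "path k u x p p'"
  shows "p \<in> monomials (verts G) u x" "p' \<in> monomials (verts G) x u"
proof -
  have x: "x \<in> verts G" using path_closed[OF assms] by simp
  show "p \<in> monomials (verts G) u x" "p' \<in> monomials (verts G) x u"
    using monomialsI[OF x assms trivial[OF x]] monomialsI[OF x trivial[OF x] assms] path_ends[OF assms]
    by simp_all
qed

text \<open>In \<open>(p q\<^sup>*)(r t\<^sup>*)\<close> the factor \<open>q\<^sup>* r\<close> is \<open>0\<close>, a path or a ghost path. The range of the product can be
  reached from the ranges of both factors, hence the intersection.\<close>

lemma monomials_mult:
  assumes hereditary: "hereditary X" "hereditary Y"
    and m: "m \<in> monomials X u v" and n: "n \<in> monomials Y v' w"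
  shows "m \<otimes> n = \<zero> \<or> m \<otimes> n \<in> monomials (X \<inter> Y) u w"
proof -
  obtain k l x p p' q q' where 1: "x \<in> X" "path k u x p p'" "path l v x q q'" "m = p \<otimes> q'"
    using m by (rule monomialsE)
  obtain i j y r r' t t' where 2: "y \<in> Y" "path i v' y r r'" "path j w y t t'" "n = r \<otimes> t'"
    using n by (rule monomialsE)
  note closed = path_closed[OF 1(2)] path_closed[OF 1(3)] path_closed[OF 2(2)] path_closed[OF 2(3)]
  have mn: "m \<otimes> n = p \<otimes> ((q' \<otimes> r) \<otimes> t')" using 1 2 closed by (simp add: m_assoc)
  show ?thesis
  proof (cases "v = v'")
    case False
    have "q' \<otimes> r = (q' \<otimes> V v) \<otimes> r" using path_ends[OF 1(3)] by simp
    also have "\<dots> = \<zero>" using False closed V_path[OF _ 2(2), of v] by (simp add: m_assoc)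
    finally show ?thesis using mn closed by simp
  next
    case True
    show ?thesis
    proof (rule path_compare[OF 1(3) 2(2)[folded True]])
      assume "q' \<otimes> r = \<zero>"
      then show ?thesis using mn closed by simp
    next
      fix h s s' assume s: "path h x y s s'" "q' \<otimes> r = s"
      have "m \<otimes> n = (p \<otimes> s) \<otimes> t'" using mn s closed path_closed[OF s(1)] by (simp add: m_assoc)
      moreover have "y \<in> X \<inter> Y" using s 1 2 hereditary unfolding hereditary_def by blast
      ultimately show ?thesis using monomialsI path_append[OF 1(2) s(1)] 2(3) by metis
    next
      fix h s s' assume s: "path h y x s s'" "q' \<otimes> r = s'"
      have "m \<otimes> n = p \<otimes> (s' \<otimes> t')" using mn s closed path_closed[OF s(1)] by (simp add: m_assoc)
      moreover have "x \<in> X \<inter> Y" using s 1 2 hereditary unfolding hereditary_def by blast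
      ultimately show ?thesis using monomialsI path_append[OF 2(3) s(1)] 1(2) by metis
    qed
  qed
qed

definition all_monomials :: "'v set \<Rightarrow> 'a set" where
  "all_monomials X = (\<Union>u\<in>verts G. \<Union>v\<in>verts G. monomials X u v)"

lemma all_monomials_closed: "all_monomials X \<subseteq> carrier A"
  using monomials_closed by (auto simp: all_monomials_def)

lemma all_monomials_mult:
  assumes "hereditary X" "hereditary Y" "m \<in> all_monomials X" "n \<in> all_monomials Y"
  shows "m \<otimes> n \<in> finite_sums (all_monomials (X \<inter> Y))"
proof -
  from assms(3,4) obtain u v v' w where *: "u \<in> verts G" "w \<in> verts G" "m \<in> monomials X u v" "n \<in> monomials Y v' w"
    unfolding all_monomials_def by blast
  have "monomials (X \<inter> Y) u w \<subseteq> all_monomials (X \<inter> Y)" using * (1,2) by (auto simp: all_monomials_def)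
  with monomials_mult[OF assms(1,2) * (3,4)] show ?thesis
    using finite_sums.zero finite_sums_summand[OF _ all_monomials_closed] by fastforce
qed

lemma finite_sums_all_monomials_mult:
  assumes "hereditary X" "hereditary Y" "x \<in> finite_sums (all_monomials X)" "y \<in> finite_sums (all_monomials Y)"
  shows "x \<otimes> y \<in> finite_sums (all_monomials (X \<inter> Y))"
  using assms(3,4) all_monomials_closed all_monomials_closed all_monomials_closed
  by (rule finite_sums_mult) (rule all_monomials_mult[OF assms(1,2)])

lemma carrier_zero:
  assumes "\<And>v. v \<in> verts G \<Longrightarrow> V v = \<zero>"
  shows "carrier A = {\<zero>}"
proof -
  have "E e = \<zero>" "E' e = \<zero>" if e: "e \<in> arcs G" for e
  proof -
    have "V (tail G e) = \<zero>" "V (head G e) = \<zero>" using assms e by auto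
    then show "E e = \<zero>" "E' e = \<zero>" using V_E[OF e] V_E'[OF e] e by (metis E_closed E'_closed l_null)+
  qed
  then have "carrier A \<subseteq> {\<zero>}" using assms by (intro generated) auto
  then show ?thesis by auto
qed

text \<open>Each generator \<open>g\<close> satisfies \<open>v g = g\<close> for a vertex \<open>v\<close>, so \<open>s g = v (s g) \<in> I\<close> for every scalar \<open>s\<close>. An
  ideal of the hemiring need not be closed under scalars, so the induction over \<open>A\<close> carries all scalar
  multiples along.\<close>

lemma ideal_eq_carrier:
  assumes I: "hemiring_ideal A I" and V: "\<And>v. v \<in> verts G \<Longrightarrow> V v \<in> I"
  shows "I = carrier A"
proof
  note I' = hemiring_idealD[OF I]
  show "I \<subseteq> carrier A" by (rule I')
  have local_unit: "s \<odot> x \<in> I" if "v \<in> verts G" "x \<in> carrier A" "V v \<otimes> x = x" for s x v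
  proof -
    have "s \<odot> x = V v \<otimes> (s \<odot> x)" using that by (simp add: smult_mult_r)
    also have "\<dots> \<in> I" using that V I' by simp
    finally show ?thesis .
  qed
  have "carrier A \<subseteq> {x \<in> carrier A. \<forall>s. s \<odot> x \<in> I}"
  proof (rule generated)
    show "V v \<in> {x \<in> carrier A. \<forall>s. s \<odot> x \<in> I}" if "v \<in> verts G" for v
      using that local_unit[of v "V v"] by (simp add: V_V)
    show "E e \<in> {x \<in> carrier A. \<forall>s. s \<odot> x \<in> I}" if "e \<in> arcs G" for e
      using that local_unit[of "tail G e" "E e"] by (simp add: V_E)
    show "E' e \<in> {x \<in> carrier A. \<forall>s. s \<odot> x \<in> I}" if "e \<in> arcs G" for e
      using that local_unit[of "head G e" "E' e"] by (simp add: V_E')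
  next
    fix s x assume "x \<in> {x \<in> carrier A. \<forall>s. s \<odot> x \<in> I}"
    then show "s \<odot> x \<in> {x \<in> carrier A. \<forall>s. s \<odot> x \<in> I}" by (simp flip: smult_assoc)
  qed (use I' in \<open>auto simp: smult_r_distr simp flip: smult_mult_l\<close>)
  moreover have "x \<in> I" if "x \<in> {x \<in> carrier A. \<forall>s. s \<odot> x \<in> I}" for x
      proof -
    from that have "x \<in> carrier A" "1 \<odot> x \<in> I" by blast+
    then show ?thesis by simp
  qed
  ultimately show "carrier A \<subseteq> I" by (rule subset_trans[OF _ subsetI])
qed

end


section \<open>The idempotent case\<close>

text \<open>The nonzero congruence-simple algebras that are not rings; idempotency follows from zerosumfreeness.\<close>

locale idempotent_simple_path_algebra = path_algebra A G V E E'
  for A :: "('s::{comm_semiring_0, comm_monoid_mult}, 'a, 'm) module_scheme" (structure)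
    and G :: "('v, 'e) pre_digraph" and V E E' +
  assumes simple: "congruence_simple A"
    and zerosumfree: "\<lbrakk>x \<in> carrier A; y \<in> carrier A; x \<oplus> y = \<zero>\<rbrakk> \<Longrightarrow> x = \<zero>"
    and nontrivial: "carrier A \<noteq> {\<zero>}"
begin

lemma add_idem: "x \<oplus> x = x" if x: "x \<in> carrier A"
proof -
  have "x \<oplus> 1 \<odot> x = x" using scalar_absorbed[OF simple _ x] zerosumfree by blast
  then show ?thesis using x by simp
qed

lemma add_eq_zero_iff: "\<lbrakk>x \<in> carrier A; y \<in> carrier A\<rbrakk> \<Longrightarrow> x \<oplus> y = \<zero> \<longleftrightarrow> x = \<zero> \<and> y = \<zero>"
  using zerosumfree[of x y] by auto

text \<open>Monomials span \<open>A\<close> without coefficients, because every scalar acts as \<open>0\<close> or \<open>1\<close>.\<close>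

lemma carrier_eq_sums: "carrier A = finite_sums (all_monomials (verts G))"
proof
  show "finite_sums (all_monomials (verts G)) \<subseteq> carrier A"
    using finite_sums_closed all_monomials_closed by blast
  note summand = finite_sums_summand[OF _ all_monomials_closed]
  show "carrier A \<subseteq> finite_sums (all_monomials (verts G))"
  proof (rule generated)
    have path: "p \<in> finite_sums (all_monomials (verts G))" "p' \<in> finite_sums (all_monomials (verts G))"
      if "path k u v p p'" for k u v p p'
    proof -
      have "p \<in> all_monomials (verts G)" "p' \<in> all_monomials (verts G)"
        using path_monomial[OF that] path_closed[OF that] unfolding all_monomials_def by blast+
      then show "p \<in> finite_sums (all_monomials (verts G))" "p' \<in> finite_sums (all_monomials (verts G))"
        by (auto intro: summand)
    qed
    show "V v \<in> finite_sums (all_monomials (verts G))" if "v \<in> verts G" for v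
      using path(1)[OF trivial[OF that]] .
    show "E e \<in> finite_sums (all_monomials (verts G))" "E' e \<in> finite_sums (all_monomials (verts G))"
      if "e \<in> arcs G" for e
      using path[OF cons[OF that trivial]] that by (simp_all add: E_V V_E')
    show "x \<otimes> y \<in> finite_sums (all_monomials (verts G))"
      if "x \<in> finite_sums (all_monomials (verts G))" "y \<in> finite_sums (all_monomials (verts G))" for x y
      using finite_sums_all_monomials_mult[OF hereditary_verts hereditary_verts that] by simp
    show "s \<odot> x \<in> finite_sums (all_monomials (verts G))" if "x \<in> finite_sums (all_monomials (verts G))" for s x
    proof -
      have "x \<in> carrier A" using that all_monomials_closed by (rule finite_sums_closed)
      then show ?thesis
        using that by (rule_tac s = s in scalar_zero_or_one[OF simple zerosumfree]) (auto simp: finite_sums.zero)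
    qed
  qed (simp_all add: finite_sums.zero finite_sums_add all_monomials_closed)
qed

lemma nonzero_vertex: obtains v where "v \<in> verts G" "V v \<noteq> \<zero>"
  using carrier_zero nontrivial by blast

text \<open>Since \<open>A\<close> is zerosumfree, \<open>s x t = 0\<close> can be checked on the monomials of \<open>s = \<Sum> a b\<^sup>*\<close> and
  \<open>t = \<Sum> c d\<^sup>*\<close>, and there only \<open>b\<^sup>* x c\<close> matters, because \<open>a\<^sup>* a\<close> and \<open>d\<^sup>* d\<close> are vertices.\<close>

lemma separation_sandwich:
  assumes x: "x \<in> carrier A" and y: "y \<in> carrier A"
    and sep: "\<And>k l u v w z b b' c c'. \<lbrakk>path k u w b b'; path l v z c c'; b' \<otimes> x \<otimes> c = \<zero>\<rbrakk> \<Longrightarrow> b' \<otimes> y \<otimes> c = \<zero>"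
    and s: "s \<in> carrier A" and t: "t \<in> carrier A" and zero: "s \<otimes> x \<otimes> t = \<zero>"
  shows "s \<otimes> y \<otimes> t = \<zero>"
proof -
  have mono: "m \<otimes> y \<otimes> n = \<zero>" if m: "m \<in> all_monomials (verts G)" and n: "n \<in> all_monomials (verts G)"
    and zero: "m \<otimes> x \<otimes> n = \<zero>" for m n
  proof -
    from m n obtain k l u w a a' b b' k' l' v u' v' z c c' d d' where
      *: "path k u w a a'" "path l v w b b'" "m = a \<otimes> b'"
         "path k' u' z c c'" "path l' v' z d d'" "n = c \<otimes> d'"
      unfolding all_monomials_def monomials_def by blast
    note closed = path_closed[OF *(1)] path_closed[OF *(2)] path_closed[OF *(4)] path_closed[OF *(5)]
    have "a' \<otimes> a = V w" "d' \<otimes> d = V z" by (rule path_ghost_path * )+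
    then have unit: "a' \<otimes> m = b'" "n \<otimes> d = c"
      using * closed path_ends(4)[OF * (2)] path_ends(3)[OF * (4)]
      by (simp_all add: m_assoc) (simp flip: m_assoc)
    have "b' \<otimes> x \<otimes> c = (a' \<otimes> m) \<otimes> x \<otimes> (n \<otimes> d)" by (simp only: unit)
    also have "\<dots> = a' \<otimes> (m \<otimes> x \<otimes> n) \<otimes> d" using * closed x by (simp add: m_assoc)
    also have "\<dots> = \<zero>" using zero closed by simp
    finally have "b' \<otimes> y \<otimes> c = \<zero>" using sep * by blast
    moreover have "m \<otimes> y \<otimes> n = a \<otimes> (b' \<otimes> y \<otimes> c) \<otimes> d'" using * closed y by (simp add: m_assoc)
    ultimately show ?thesis using closed by simp
  qed
  have in_carrier: "m \<in> carrier A" if "m \<in> all_monomials (verts G)" for m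
    using that all_monomials_closed by blast
  have left: "s \<otimes> y \<otimes> n = \<zero>"
    if s: "s \<in> finite_sums (all_monomials (verts G))" and n: "n \<in> all_monomials (verts G)"
      and zero: "s \<otimes> x \<otimes> n = \<zero>" for s n
    using s zero
  proof (induction rule: finite_sums.induct)
    case (add m s)
    then have "m \<in> carrier A" "s \<in> carrier A" "n \<in> carrier A"
      using n in_carrier carrier_eq_sums by auto
    with add mono[OF add(1) n] show ?case using x y by (simp add: l_distr add_eq_zero_iff)
  qed (use y n in_carrier in simp)
  from s t have "s \<in> finite_sums (all_monomials (verts G))" "t \<in> finite_sums (all_monomials (verts G))"
    using carrier_eq_sums by auto
  from this(2) zero show ?thesis
  proof (induction rule: finite_sums.induct)
    case (add n t)
    then have "n \<in> carrier A" "t \<in> carrier A" using in_carrier carrier_eq_sums by auto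
    with add left[OF \<open>s \<in> finite_sums _\<close> add(1)] show ?case using s x y by (simp add: r_distr add_eq_zero_iff)
  qed (use s y in simp)
qed

text \<open>Having the same annihilating pairs \<open>(s, t)\<close> is a congruence. It separates \<open>0\<close> from each nonzero
  vertex \<open>v\<close>, as \<open>v v v = v\<close>, so it is equality.\<close>

lemma separation:
  assumes x: "x \<in> carrier A" and y: "y \<in> carrier A"
    and sep: "\<And>k l u v w z b b' c c'. \<lbrakk>path k u w b b'; path l v z c c'\<rbrakk>
      \<Longrightarrow> b' \<otimes> x \<otimes> c = \<zero> \<longleftrightarrow> b' \<otimes> y \<otimes> c = \<zero>"
  shows "x = y"
proof -
  define P where "P x y \<longleftrightarrow> (\<forall>s\<in>carrier A. \<forall>t\<in>carrier A. s \<otimes> x \<otimes> t = \<zero> \<longleftrightarrow> s \<otimes> y \<otimes> t = \<zero>)" for x y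
  have PD: "s \<otimes> x \<otimes> t = \<zero> \<longleftrightarrow> s \<otimes> y \<otimes> t = \<zero>" if "P x y" "s \<in> carrier A" "t \<in> carrier A" for s t x y
    using that by (simp add: P_def)
  show ?thesis
  proof (rule congruence_dichotomy[OF simple, of P])
    assume "\<And>x y. \<lbrakk>x \<in> carrier A; y \<in> carrier A; P x y\<rbrakk> \<Longrightarrow> x = y"
    moreover have "P x y" unfolding P_def
    proof (intro ballI iffI)
      fix s t assume s: "s \<in> carrier A" and t: "t \<in> carrier A"
      show "s \<otimes> y \<otimes> t = \<zero>" if "s \<otimes> x \<otimes> t = \<zero>"
        by (rule separation_sandwich[OF x y _ s t that]) (simp add: sep)
      show "s \<otimes> x \<otimes> t = \<zero>" if "s \<otimes> y \<otimes> t = \<zero>"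
        by (rule separation_sandwich[OF y x _ s t that]) (simp add: sep)
    qed
    ultimately show ?thesis using x y by blast
  next
    assume total: "\<And>x y. \<lbrakk>x \<in> carrier A; y \<in> carrier A\<rbrakk> \<Longrightarrow> P x y"
    obtain v where v: "v \<in> verts G" "V v \<noteq> \<zero>" by (rule nonzero_vertex)
    have "V v \<otimes> V v \<otimes> V v = \<zero>" using PD[OF total[OF zero_closed V_closed[OF v(1)]], of "V v" "V v"] v by simp
    then show ?thesis using v by (simp add: V_V)
  next
    fix x y z assume *: "x \<in> carrier A" "y \<in> carrier A" "z \<in> carrier A" "P x y"
    show "P (z \<oplus> x) (z \<oplus> y)" unfolding P_def
      using * PD[OF * (4)] by (simp add: l_distr r_distr add_eq_zero_iff)
    show "P (z \<otimes> x) (z \<otimes> y)" unfolding P_def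
      using * PD[OF * (4)] by (simp flip: m_assoc)
    show "P (x \<otimes> z) (y \<otimes> z)" unfolding P_def
    proof (intro ballI)
      fix s t assume "s \<in> carrier A" "t \<in> carrier A"
      then show "s \<otimes> (x \<otimes> z) \<otimes> t = \<zero> \<longleftrightarrow> s \<otimes> (y \<otimes> z) \<otimes> t = \<zero>"
        using * PD[OF * (4), of s "z \<otimes> t"] by (simp add: m_assoc)
    qed
  qed (auto simp: P_def)
qed

end

section \<open>Nonzero vertices in ideals\<close>

context idempotent_simple_path_algebra
begin

lemma conjugate_monomial:
  assumes q: "path k v w q q'" and m: "m \<in> monomials (verts G) v v"
  shows "q' \<otimes> m \<otimes> q = \<zero> \<or> q' \<otimes> m \<otimes> q \<in> monomials (verts G) w w"
proof -
  note mult = monomials_mult[OF hereditary_verts hereditary_verts]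
  have "q' \<otimes> m = \<zero> \<or> q' \<otimes> m \<in> monomials (verts G) w v"
    using mult[OF path_monomial(2)[OF q] m] by simp
  then show ?thesis
    using mult[OF _ path_monomial(1)[OF q], of "q' \<otimes> m" w v] path_closed[OF q] by auto
qed

text \<open>
  If \<open>p q\<^sup>* \<le> v\<close> fails, then \<open>separation\<close> gives paths \<open>b, c\<close> from \<open>v\<close> with \<open>b\<^sup>* c = 0\<close> but \<open>b\<^sup>* p q\<^sup>* c \<noteq> 0\<close>.
  The inequality makes \<open>b\<close> comparable to \<open>p\<close> and \<open>c\<close> to \<open>q\<close>. Orthogonality survives extension of \<open>b\<close> and
  \<open>c\<close>, so they may be taken as \<open>p r\<close> and \<open>q s\<close>. Then \<open>r\<^sup>* s \<noteq> 0\<close>, so \<open>r\<close> and \<open>s\<close> are comparable, and the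
  longer of them serves as a common extension.
\<close>

lemma orthogonal_translates:
  assumes p: "path m v x p p'" and q: "path n v x q q'" and ne: "V v \<oplus> p \<otimes> q' \<noteq> V v"
  obtains k d c c' where "path k x d c c'" "V d \<noteq> \<zero>" "(c' \<otimes> p') \<otimes> (q \<otimes> c) = \<zero>"
proof -
  note closed = path_closed[OF p] path_closed[OF q]
  have "\<exists>k l u w z u' b b' c c'. path k u w b b' \<and> path l u' z c c' \<and>
      \<not> (b' \<otimes> (V v \<oplus> p \<otimes> q') \<otimes> c = \<zero> \<longleftrightarrow> b' \<otimes> V v \<otimes> c = \<zero>)"
  proof (rule ccontr)
    assume "\<not> ?thesis"
    then have "b' \<otimes> (V v \<oplus> p \<otimes> q') \<otimes> c = \<zero> \<longleftrightarrow> b' \<otimes> V v \<otimes> c = \<zero>"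
      if "path k u w b b'" "path l u' z c c'" for k l u w z u' b b' c c'
      using that by blast
    then have "V v \<oplus> p \<otimes> q' = V v" using closed by (intro separation) auto
    with ne show False by contradiction
  qed
  then obtain k l u w z u' b b' c c' where b: "path k u w b b'" and c: "path l u' z c c'"
    and ne: "\<not> (b' \<otimes> (V v \<oplus> p \<otimes> q') \<otimes> c = \<zero> \<longleftrightarrow> b' \<otimes> V v \<otimes> c = \<zero>)"
    by blast
  note closed = closed path_closed[OF b] path_closed[OF c]
  have "b' \<otimes> (V v \<oplus> p \<otimes> q') \<otimes> c = b' \<otimes> V v \<otimes> c \<oplus> (b' \<otimes> p) \<otimes> (q' \<otimes> c)"
    using closed by (simp add: l_distr r_distr m_assoc)
  with ne have zero: "b' \<otimes> V v \<otimes> c = \<zero>" and nonzero: "(b' \<otimes> p) \<otimes> (q' \<otimes> c) \<noteq> \<zero>"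
    using closed by (auto simp: add_eq_zero_iff)
  have u: "u = v"
  proof (rule ccontr)
    assume "u \<noteq> v"
    have "b' \<otimes> p = (b' \<otimes> V v) \<otimes> p" using closed path_ends[OF p] by (simp add: m_assoc)
    with \<open>u \<noteq> v\<close> nonzero closed show False by (simp add: path_V[OF _ b])
  qed
  have u': "u' = v"
  proof (rule ccontr)
    assume "u' \<noteq> v"
    have "q' \<otimes> c = q' \<otimes> (V v \<otimes> c)" using closed path_ends[OF q] by (simp flip: m_assoc)
    with \<open>u' \<noteq> v\<close> nonzero closed show False by (simp add: V_path[OF _ c])
  qed
  note b = b[unfolded u] and c = c[unfolded u']
  have zero: "b' \<otimes> c = \<zero>" using zero path_ends[OF b] by simp
  \<comment> \<open>Replace \<open>b\<close> by an extension \<open>p r\<close> of \<open>p\<close>, with trivial \<open>r\<close> if \<open>b\<close> is shorter than \<open>p\<close>.\<close>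
  obtain k y r r' where r: "path k x y r r'" "(r' \<otimes> p') \<otimes> c = \<zero>" "r' \<otimes> (q' \<otimes> c) \<noteq> \<zero>"
  proof (rule path_compare[OF b p])
    fix k r r' assume r: "path k w x r r'" "p = b \<otimes> r" "p' = r' \<otimes> b'" "b' \<otimes> p = r"
    have "p' \<otimes> c = r' \<otimes> (b' \<otimes> c)" using r path_closed[OF r(1)] closed by (simp add: m_assoc)
    then have "(V x \<otimes> p') \<otimes> c = \<zero>" using zero path_closed[OF r(1)] path_ends[OF p] by simp
    moreover have "q' \<otimes> c \<noteq> \<zero>" using nonzero r path_closed[OF r(1)] by auto
    moreover have "V x \<otimes> (q' \<otimes> c) = q' \<otimes> c" using path_ends[OF q] closed by (simp flip: m_assoc)
    ultimately show thesis using that[OF trivial[of x]] closed by simp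
  next
    fix k r r' assume r: "path k x w r r'" "b = p \<otimes> r" "b' = r' \<otimes> p'" "b' \<otimes> p = r'"
    then show thesis using that[OF r(1)] zero nonzero by simp
  qed (use nonzero closed in simp)
  note closed = closed path_closed[OF r(1)]
  \<comment> \<open>Likewise, replace \<open>c\<close> by \<open>q s\<close>.\<close>
  obtain l z s s' where s: "path l x z s s'" "(r' \<otimes> p') \<otimes> (q \<otimes> s) = \<zero>" "r' \<otimes> s \<noteq> \<zero>"
  proof (rule path_compare[OF q c])
    fix k s s' assume s: "path k x z s s'" "c = q \<otimes> s" "q' \<otimes> c = s"
    then show thesis using that[OF s(1)] r by simp
  next
    fix k s s' assume s: "path k z x s s'" "q = c \<otimes> s" "q' \<otimes> c = s'"
    have "(r' \<otimes> p') \<otimes> q = ((r' \<otimes> p') \<otimes> c) \<otimes> s" using s path_closed[OF s(1)] closed by (simp add: m_assoc)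
    then have "(r' \<otimes> p') \<otimes> (q \<otimes> V x) = \<zero>" using r path_closed[OF s(1)] path_ends[OF q] by simp
    moreover have "r' \<noteq> \<zero>" using r s path_closed[OF s(1)] by auto
    ultimately show thesis using that[OF trivial[of x]] closed path_ends[OF r(1)] by simp
  qed (use r closed in simp)
  note closed = closed path_closed[OF s(1)]
  show thesis
  proof (rule path_compare[OF r(1) s(1)])
    fix k t t' assume t: "path k y z t t'" "s = r \<otimes> t" "s' = t' \<otimes> r'" "r' \<otimes> s = t"
    note closed = closed path_closed[OF t(1)]
    have "(s' \<otimes> p') \<otimes> (q \<otimes> s) = t' \<otimes> ((r' \<otimes> p') \<otimes> (q \<otimes> s))"
      unfolding t(3) using closed by (simp add: m_assoc)
    then have "(s' \<otimes> p') \<otimes> (q \<otimes> s) = \<zero>" using s closed by simp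
    moreover have "V z \<noteq> \<zero>" using path_ends(3)[OF t(1)] t s closed by auto
    ultimately show thesis using that s by blast
  next
    fix k t t' assume t: "path k z y t t'" "r = s \<otimes> t" "r' = t' \<otimes> s'" "r' \<otimes> s = t'"
    note closed = closed path_closed[OF t(1)]
    have "(r' \<otimes> p') \<otimes> (q \<otimes> r) = ((r' \<otimes> p') \<otimes> (q \<otimes> s)) \<otimes> t"
      unfolding t(2) using closed by (simp add: m_assoc)
    then have "(r' \<otimes> p') \<otimes> (q \<otimes> r) = \<zero>" using s closed by simp
    moreover have "V y \<noteq> \<zero>" using path_ends(4)[OF t(1)] t s closed by auto
    ultimately show thesis using that r by blast
  qed (use s in simp)
qed

text \<open>
  For \<open>m = p q\<^sup>*\<close> the conjugating path is \<open>p c\<close>, with \<open>p c\<close> and \<open>q c\<close> orthogonal: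
  \<open>(p c)\<^sup>* p q\<^sup>* (p c) = (q c)\<^sup>* (p c) = 0\<close>.
\<close>

lemma conjugate_to_zero:
  assumes m: "m \<in> monomials (verts G) v v" and ne: "V v \<oplus> m \<noteq> V v"
  obtains k w q q' where "path k v w q q'" "V w \<noteq> \<zero>" "q' \<otimes> m \<otimes> q = \<zero>"
proof -
  obtain k l x p p' q q' where pq: "path k v x p p'" "path l v x q q'" "m = p \<otimes> q'"
    using m by (rule monomialsE)
  then obtain h d c c' where c: "path h x d c c'" "V d \<noteq> \<zero>" "(c' \<otimes> p') \<otimes> (q \<otimes> c) = \<zero>"
    using ne orthogonal_translates[OF pq(1,2)] by blast
  note closed = path_closed[OF pq(1)] path_closed[OF pq(2)] path_closed[OF c(1)]
  note pc = path_append[OF pq(1) c(1)] and qc = path_append[OF pq(2) c(1)]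
  \<comment> \<open>Orthogonality is symmetric: comparable paths with nonzero range are orthogonal in neither order.\<close>
  have zero: "(c' \<otimes> q') \<otimes> (p \<otimes> c) = \<zero>"
  proof (rule path_compare[OF pc qc])
    fix k r r' assume r: "path k d d r r'" "(c' \<otimes> p') \<otimes> (q \<otimes> c) = r"
    then have "r = \<zero>" using c by simp
    then have "V d = \<zero>" using path_ghost_path[OF r(1)] path_closed[OF r(1)] by simp
    with c(2) show ?thesis by contradiction
  next
    fix k r r' assume r: "path k d d r r'" "(c' \<otimes> p') \<otimes> (q \<otimes> c) = r'"
    then have "r' = \<zero>" using c by simp
    then have "V d = \<zero>" using path_ghost_path[OF r(1)] path_closed[OF r(1)] by simp
    with c(2) show ?thesis by contradiction
  qed
  have "(c' \<otimes> p') \<otimes> m \<otimes> (p \<otimes> c) = c' \<otimes> ((p' \<otimes> p) \<otimes> q') \<otimes> (p \<otimes> c)"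
    using closed pq by (simp add: m_assoc)
  also have "\<dots> = (c' \<otimes> q') \<otimes> (p \<otimes> c)"
    using path_ghost_path[OF pq(1)] path_ends[OF pq(2)] by simp
  finally show thesis using that[OF pc c(2)] zero by simp
qed

text \<open>A nonzero vertex lies below an element of \<open>I\<close>; conjugation by suitable paths removes the excess
  summands of that element one after another, while the vertex moves to the end of the path.\<close>

lemma nonzero_vertex_in_ideal:
  assumes I: "hemiring_ideal A I" "I \<noteq> {\<zero>}"
  obtains v where "v \<in> verts G" "V v \<noteq> \<zero>" "V v \<in> I"
proof -
  note I' = hemiring_idealD[OF I(1)]
  obtain v where v: "v \<in> verts G" "V v \<noteq> \<zero>" by (rule nonzero_vertex)
  obtain a b where ab: "a \<in> I" "b \<in> I" "V v \<oplus> a = b" by (rule ideal_absorbs[OF simple I V_closed[OF v(1)]])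
  have a: "a \<in> carrier A" using ab I' by auto
  have eq: "V v \<oplus> V v \<otimes> a \<otimes> V v = V v \<otimes> b \<otimes> V v"
    using v a by (simp add: r_distr l_distr V_V flip: ab(3))
  have vav: "V v \<otimes> a \<otimes> V v \<in> finite_sums (monomials (verts G) v v)"
  proof (rule finite_sums_conjugate[of a "all_monomials (verts G)"])
    show "V v \<otimes> m \<otimes> V v \<in> finite_sums (monomials (verts G) v v)" if m: "m \<in> all_monomials (verts G)" for m
    proof -
      obtain u w where uw: "u \<in> verts G" "w \<in> verts G" "m \<in> monomials (verts G) u w"
        using m unfolding all_monomials_def by blast
      then show ?thesis
        using v monomials_V[OF uw(3) v(1)] finite_sums_summand[OF _ monomials_closed]
        by (auto simp: finite_sums.zero)
    qed
  qed (use a v carrier_eq_sums all_monomials_closed monomials_closed in auto)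
  \<comment> \<open>The summands still to be removed are those of \<open>y\<close>; \<open>q\<close> is the product of the conjugating paths
    used so far, so that the induction may keep \<open>y\<close> itself unconjugated.\<close>
  have "\<exists>u\<in>verts G. V u \<noteq> \<zero> \<and> V u \<in> I"
    if "y \<in> finite_sums (monomials (verts G) v v)" "path k v w q q'" "V w \<noteq> \<zero>" "V w \<oplus> q' \<otimes> y \<otimes> q \<in> I"
    for y k w q q'
    using that
  proof (induction arbitrary: k w q q' rule: finite_sums.induct)
    case zero
    then show ?case using path_closed[OF zero(1)] by auto
  next
    case (add m y)
    note q = path_closed[OF add(4)]
    have closed: "m \<in> carrier A" "y \<in> carrier A"
      using add(1) finite_sums_closed[OF add(2) monomials_closed] monomials_closed by auto
    define b where "b = q' \<otimes> m \<otimes> q"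
    have b: "b \<in> carrier A" using q closed by (simp add: b_def)
    have expand: "q' \<otimes> (m \<oplus> y) \<otimes> q = b \<oplus> q' \<otimes> y \<otimes> q"
      using q closed by (simp add: b_def r_distr l_distr)
    show ?case
    proof (cases "V w \<oplus> b = V w")
      case True
      have "V w \<oplus> q' \<otimes> y \<otimes> q = V w \<oplus> q' \<otimes> (m \<oplus> y) \<otimes> q"
        using True q b closed by (simp add: expand flip: a_assoc)
      with add.prems show ?thesis by (intro add.IH) auto
    next
      case False
      then have "b \<noteq> \<zero>" using q by auto
      then have "b \<in> monomials (verts G) w w" using conjugate_monomial[OF add(4,1)] by (simp add: b_def)
      then obtain j x c c' where c: "path j w x c c'" "V x \<noteq> \<zero>" "c' \<otimes> b \<otimes> c = \<zero>"
        using False conjugate_to_zero by blast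
      note closed = closed q b path_closed[OF c(1)]
      have "c' \<otimes> (V w \<oplus> q' \<otimes> (m \<oplus> y) \<otimes> q) \<otimes> c
          = (c' \<otimes> V w) \<otimes> c \<oplus> (c' \<otimes> b \<otimes> c \<oplus> (c' \<otimes> q') \<otimes> y \<otimes> (q \<otimes> c))"
        unfolding expand using closed by (simp add: r_distr l_distr m_assoc)
      also have "\<dots> = V x \<oplus> (c' \<otimes> q') \<otimes> y \<otimes> (q \<otimes> c)"
        using closed c path_ends[OF c(1)] path_ghost_path[OF c(1)] by simp
      finally have "V x \<oplus> (c' \<otimes> q') \<otimes> y \<otimes> (q \<otimes> c) \<in> I"
        using I'(4,5) add.prems(3) closed by metis
      then show ?thesis using add.IH[OF path_append[OF add(4) c(1)] c(2)] by blast
    qed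
  qed
  moreover have "V v \<oplus> V v \<otimes> (V v \<otimes> a \<otimes> V v) \<otimes> V v \<in> I"
  proof -
    have "V v \<otimes> (V v \<otimes> a \<otimes> V v) \<otimes> V v = (V v \<otimes> V v) \<otimes> a \<otimes> (V v \<otimes> V v)"
      using v a by (simp add: m_assoc)
    also have "\<dots> = V v \<otimes> a \<otimes> V v" using v by (simp add: V_V)
    finally show ?thesis using I'(4,5) ab v by (simp add: eq)
  qed
  ultimately show thesis using vav trivial[OF v(1)] v(2) that by blast
qed

end

section \<open>Range projections\<close>

context path_algebra
begin

definition range_projection :: "'e set \<Rightarrow> 'a" where
  "range_projection F = (\<Oplus>e\<in>F. E e \<otimes> E' e)"

lemma range_projection_empty [simp]: "range_projection {} = \<zero>"
  by (simp add: range_projection_def)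

lemma range_projection_insert:
  assumes "finite F" "insert e F \<subseteq> arcs G" "e \<notin> F"
  shows "range_projection (insert e F) = E e \<otimes> E' e \<oplus> range_projection F"
  unfolding range_projection_def using assms by (intro finsum_insert) auto

lemma range_projection_closed: "F \<subseteq> arcs G \<Longrightarrow> range_projection F \<in> carrier A"
  unfolding range_projection_def by (intro finsum_closed) auto

lemma range_projection_E:
  assumes "finite F" "F \<subseteq> arcs G" "f \<in> arcs G"
  shows "range_projection F \<otimes> E f = (if f \<in> F then E f else \<zero>)"
  using assms
proof (induction F)
  case (insert e F)
  have "(E e \<otimes> E' e) \<otimes> E f = E e \<otimes> (E' e \<otimes> E f)" using insert by (simp add: m_assoc)
  also have "\<dots> = (if e = f then E f else \<zero>)" using insert by (auto simp: E'_E E_V)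
  finally show ?case using insert by (auto simp: range_projection_insert range_projection_closed l_distr)
qed simp

lemma E'_range_projection:
  assumes "finite F" "F \<subseteq> arcs G" "f \<in> arcs G"
  shows "E' f \<otimes> range_projection F = (if f \<in> F then E' f else \<zero>)"
  using assms
proof (induction F)
  case (insert e F)
  have "E' f \<otimes> (E e \<otimes> E' e) = (E' f \<otimes> E e) \<otimes> E' e" using insert by (simp add: m_assoc)
  also have "\<dots> = (if e = f then E' f else \<zero>)" using insert by (auto simp: E'_E V_E')
  finally show ?case using insert by (auto simp: range_projection_insert range_projection_closed r_distr)
qed simp

lemma V_range_projection:
  assumes "finite F" "F \<subseteq> out_arcs G w" "w \<in> verts G"
  shows "V w \<otimes> range_projection F = range_projection F" "range_projection F \<otimes> V w = range_projection F"
proof -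
  have "V w \<otimes> range_projection F = range_projection F \<and> range_projection F \<otimes> V w = range_projection F"
    using assms
  proof (induction F)
    case (insert e F)
    then have e: "e \<in> arcs G" "tail G e = w" "F \<subseteq> arcs G" by auto
    have "V w \<otimes> (E e \<otimes> E' e) = E e \<otimes> E' e" "(E e \<otimes> E' e) \<otimes> V w = E e \<otimes> E' e"
      using e V_E[of e] E'_V[of e] insert(5) by (simp_all add: m_assoc) (simp_all flip: m_assoc)
    with insert e show ?case by (simp add: range_projection_insert range_projection_closed l_distr r_distr)
  qed simp
  then show "V w \<otimes> range_projection F = range_projection F" "range_projection F \<otimes> V w = range_projection F"
    by simp_all
qed

lemma range_projection_in_ideal:
  assumes I: "hemiring_ideal A I" and F: "finite F" "F \<subseteq> arcs G" and V: "\<And>e. e \<in> F \<Longrightarrow> V (head G e) \<in> I"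
  shows "range_projection F \<in> I"
  using F V
proof (induction F)
  case (insert e F)
  have "E e \<otimes> V (head G e) \<otimes> E' e \<in> I" using insert hemiring_idealD(4,5)[OF I] by simp
  then show ?case
    using insert hemiring_idealD(3)[OF I] by (simp add: range_projection_insert E_V)
qed (use hemiring_idealD(2)[OF I] in simp)

end

context idempotent_simple_path_algebra
begin

text \<open>
  An edge \<open>f \<notin> F\<close> from \<open>w\<close> satisfies \<open>f\<^sup>* y = 0\<close>, hence \<open>f\<^sup>* w = 0\<close> and \<open>f = 0\<close>. So \<open>g = (\<Sum>e\<in>F. e e\<^sup>*)\<close> acts as the
  identity on all edges from \<open>w\<close>, as \<open>w\<close> does, and \<open>separation\<close> can tell \<open>g\<close> and \<open>w\<close> apart only with
  trivial paths, that is, if one of the two is \<open>0\<close> and the other is not.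
\<close>

lemma vertex_eq_range_projection:
  assumes w: "w \<in> verts G" and F: "finite F" "F \<subseteq> out_arcs G w" and y: "y \<in> carrier A"
    and below: "V w \<oplus> y = y" and fixed: "range_projection F \<otimes> y = y"
  shows "V w = range_projection F"
proof -
  let ?g = "range_projection F"
  have arcs: "F \<subseteq> arcs G" using F by auto
  note g = range_projection_closed[OF arcs] and gV = V_range_projection[OF F w]
  have unit: "?g \<otimes> E f = E f" "E' f \<otimes> ?g = E' f" if f: "f \<in> arcs G" "tail G f = w" for f
  proof -
    have "?g \<otimes> E f = E f \<and> E' f \<otimes> ?g = E' f"
    proof (cases "f \<in> F")
      case True
      then show ?thesis using f F arcs by (simp add: range_projection_E E'_range_projection)
    next
      case False
      have "E' f \<otimes> y = (E' f \<otimes> ?g) \<otimes> y" using f y g fixed by (simp add: m_assoc)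
      also have "\<dots> = \<zero>" using False f F arcs y by (simp add: E'_range_projection)
      finally have "E' f \<otimes> (V w \<oplus> y) = \<zero>" using below by simp
      then have "E' f \<otimes> V w = \<zero>" using f w y by (simp add: r_distr add_eq_zero_iff)
      then have "E' f = \<zero>" using E'_V[of f] f by simp
      moreover from this have "V (head G f) = \<zero>" using E'_E[of f f] f by simp
      then have "E f = \<zero>" using E_V[of f] f by simp
      ultimately show ?thesis using g by simp
    qed
    then show "?g \<otimes> E f = E f" "E' f \<otimes> ?g = E' f" by simp_all
  qed
  show ?thesis
  proof (rule separation[OF V_closed[OF w] g])
    fix k l u v x z b b' c c' assume b: "path k u x b b'" and c: "path l v z c c'"
    note closed = path_closed[OF b] path_closed[OF c]
    show "b' \<otimes> V w \<otimes> c = \<zero> \<longleftrightarrow> b' \<otimes> ?g \<otimes> c = \<zero>"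
    proof (cases "u = w \<and> v = w")
      case False
      have "b' \<otimes> ?g \<otimes> c = (b' \<otimes> V w) \<otimes> ?g \<otimes> c" "b' \<otimes> ?g \<otimes> c = b' \<otimes> (?g \<otimes> (V w \<otimes> c))"
        "b' \<otimes> V w \<otimes> c = b' \<otimes> (V w \<otimes> c)"
        using closed g gV w by (simp_all add: m_assoc) (simp_all flip: m_assoc)
      moreover have "b' \<otimes> V w = \<zero> \<or> V w \<otimes> c = \<zero>" using False path_V[OF w b] V_path[OF w c] by auto
      ultimately show ?thesis using closed g w by auto
    next
      case True
      then have ends: "b' \<otimes> V w = b'" "V w \<otimes> c = c" using path_ends b c by blast+
      from b show ?thesis
      proof (cases rule: path.cases)
        case (cons e n p p')
        have "b' \<otimes> ?g = p' \<otimes> (E' e \<otimes> ?g)" using cons path_closed[OF cons(6)] g by (simp add: m_assoc)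
        then show ?thesis using cons True unit(2)[of e] ends by simp
      next
        case bt: trivial
        from c show ?thesis
        proof (cases rule: path.cases)
          case (cons e n p p')
          have "?g \<otimes> c = (?g \<otimes> E e) \<otimes> p" using cons path_closed[OF cons(6)] g by (simp add: m_assoc)
          then show ?thesis using cons True unit(1)[of e] ends closed w g by (simp add: m_assoc)
        next
          case trivial
          have "V w = \<zero> \<Longrightarrow> ?g = \<zero>" using gV g by (metis l_null)
          moreover have "?g = \<zero> \<Longrightarrow> V w = \<zero>" using fixed y below w by (metis V_closed l_null r_zero)
          ultimately show ?thesis using bt trivial True gV w by (auto simp: V_V)
        qed
      qed
    qed
  qed
qed

text \<open>Only the length of \<open>p\<close> is bounded; this is enough, since conjugation by an edge shortens \<open>p\<close>.\<close>

definition short_monomials :: "'v set \<Rightarrow> nat \<Rightarrow> 'v \<Rightarrow> 'a set" where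
  "short_monomials X n w =
    {p \<otimes> q' | k l x p p' q q'. k < n \<and> x \<in> X \<and> path k w x p p' \<and> path l w x q q'}"

lemma short_monomials_closed: "short_monomials X n w \<subseteq> carrier A"
  by (auto simp: short_monomials_def dest: path_closed)

text \<open>For \<open>F\<close> take the first edges of the summands of \<open>y\<close>.\<close>

lemma fixed_by_range_projection:
  assumes "y \<in> finite_sums M" and M: "\<And>m. m \<in> M \<Longrightarrow> \<exists>e\<in>out_arcs G w. \<exists>z\<in>carrier A. m = E e \<otimes> z"
  obtains F where "finite F" "F \<subseteq> out_arcs G w" "range_projection F \<otimes> y = y"
proof -
  have sub: "M \<subseteq> carrier A" using M by fastforce
  \<comment> \<open>Supersets of \<open>F\<close> are included so that the sets for two summands can be united.\<close>
  have "\<exists>F. finite F \<and> F \<subseteq> out_arcs G w \<and>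
      (\<forall>F'. finite F' \<longrightarrow> F \<subseteq> F' \<longrightarrow> F' \<subseteq> out_arcs G w \<longrightarrow> range_projection F' \<otimes> y = y)"
    using assms(1)
  proof (induction rule: finite_sums.induct)
    case zero
    show ?case by (intro exI[of _ "{}"]) (auto intro!: r_null range_projection_closed)
  next
    case (add m y)
    then obtain F where F: "finite F" "F \<subseteq> out_arcs G w"
      "\<And>F'. \<lbrakk>finite F'; F \<subseteq> F'; F' \<subseteq> out_arcs G w\<rbrakk> \<Longrightarrow> range_projection F' \<otimes> y = y" by blast
    obtain e z where e: "e \<in> out_arcs G w" "z \<in> carrier A" "m = E e \<otimes> z" using M[OF add(1)] by blast
    have y: "y \<in> carrier A" using finite_sums_closed[OF add(2) sub] .
    have "range_projection F' \<otimes> (m \<oplus> y) = m \<oplus> y"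
      if F': "finite F'" "insert e F \<subseteq> F'" "F' \<subseteq> out_arcs G w" for F'
    proof -
      have arcs: "F' \<subseteq> arcs G" using F' by auto
      have "range_projection F' \<otimes> m = (range_projection F' \<otimes> E e) \<otimes> z"
        using e range_projection_closed[OF arcs] by (simp add: m_assoc)
      also have "\<dots> = m" using F' arcs e by (simp add: range_projection_E)
      finally show ?thesis using F(3)[of F'] F' e y range_projection_closed[OF arcs] by (simp add: r_distr)
    qed
    then show ?case using F(1,2) e(1) by (intro exI[of _ "insert e F"]) auto
  qed
  then show thesis using that by blast
qed

text \<open>
  Suppose \<open>w \<notin> I\<close>. A summand \<open>p q\<^sup>*\<close> of \<open>y\<close> with \<open>p\<close> or \<open>q\<close> trivial would have range \<open>w\<close>, so both start with an
  edge. Then \<open>w\<close> is a finite sum of elements \<open>e e\<^sup>*\<close>, and the range of \<open>e\<close> lies below \<open>e\<^sup>* y e\<close>, whose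
  summands are shorter. With the bound \<open>n = 0\<close> there are no summands, so \<open>w = 0\<close>.
\<close>

lemma vertex_below_short_monomials:
  assumes I: "hemiring_ideal A I" and X: "\<And>x. x \<in> X \<Longrightarrow> V x \<in> I"
    and w: "w \<in> verts G" and y: "y \<in> finite_sums (short_monomials X n w)" and below: "V w \<oplus> y = y"
  shows "V w \<in> I"
  using w y below
proof (induction n arbitrary: w y)
  case 0
  from 0(2) have "y = \<zero>" by (cases rule: finite_sums.cases) (auto simp: short_monomials_def)
  with 0 have "V w = \<zero>" by simp
  then show ?case using hemiring_idealD[OF I] by simp
next
  case (Suc n)
  have y: "y \<in> carrier A" using Suc(3) short_monomials_closed by (rule finite_sums_closed)
  show ?case
  proof (rule ccontr)
    assume notin: "V w \<notin> I"
    have split: "\<exists>e f p q'. e \<in> out_arcs G w \<and> f \<in> out_arcs G w \<and> p \<in> carrier A \<and> q' \<in> carrier A \<and>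
        m = (E e \<otimes> p) \<otimes> (q' \<otimes> E' f) \<and> (e = f \<longrightarrow> p \<otimes> q' \<in> short_monomials X n (head G e)) \<and>
        V (head G e) \<otimes> p = p \<and> q' \<otimes> V (head G f) = q'"
      if m: "m \<in> short_monomials X (Suc n) w" for m
    proof -
      obtain k l x p p' q q' where *: "k < Suc n" "x \<in> X" "path k w x p p'" "path l w x q q'" "m = p \<otimes> q'"
        using m unfolding short_monomials_def by blast
      have "w \<noteq> x" using X[OF * (2)] notin by auto
      obtain e h r r' where e: "e \<in> arcs G" "tail G e = w" "path h (head G e) x r r'" "p = E e \<otimes> r" "k = Suc h"
        using * (3) \<open>w \<noteq> x\<close> by (cases rule: path.cases) auto
      obtain f j t t' where f: "f \<in> arcs G" "tail G f = w" "path j (head G f) x t t'" "q' = t' \<otimes> E' f"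
        using * (4) \<open>w \<noteq> x\<close> by (cases rule: path.cases) auto
      have "r \<otimes> t' \<in> short_monomials X n (head G e)" if "e = f"
        using * e f that unfolding short_monomials_def by fastforce
      then show ?thesis
        using * e f path_closed[OF e(3)] path_closed[OF f(3)] path_ends[OF e(3)] path_ends[OF f(3)]
        by (intro exI[of _ e] exI[of _ f] exI[of _ r] exI[of _ t']) auto
    qed
    have "\<exists>e\<in>out_arcs G w. \<exists>z\<in>carrier A. m = E e \<otimes> z" if m: "m \<in> short_monomials X (Suc n) w" for m
    proof -
      obtain e f p q' where *: "e \<in> out_arcs G w" "f \<in> out_arcs G w" "p \<in> carrier A" "q' \<in> carrier A"
        "m = (E e \<otimes> p) \<otimes> (q' \<otimes> E' f)" using split[OF m] by blast
      then have "m = E e \<otimes> (p \<otimes> (q' \<otimes> E' f))" by (simp add: m_assoc)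
      with * show ?thesis by (intro bexI[of _ e] bexI[of _ "p \<otimes> (q' \<otimes> E' f)"]) auto
    qed
    from fixed_by_range_projection[OF Suc(3) this]
    obtain F where F: "finite F" "F \<subseteq> out_arcs G w" "range_projection F \<otimes> y = y" by blast
    have "V (head G e) \<in> I" if e: "e \<in> out_arcs G w" for e
    proof (rule Suc.IH)
      have e': "e \<in> arcs G" "tail G e = w" using e by auto
      show "head G e \<in> verts G" using e' by simp
      show "E' e \<otimes> y \<otimes> E e \<in> finite_sums (short_monomials X n (head G e))"
      proof (rule finite_sums_conjugate[OF Suc(3)])
        fix m assume "m \<in> short_monomials X (Suc n) w"
        then obtain f h p q' where *: "f \<in> out_arcs G w" "h \<in> out_arcs G w" "p \<in> carrier A" "q' \<in> carrier A"
          "m = (E f \<otimes> p) \<otimes> (q' \<otimes> E' h)" "f = h \<longrightarrow> p \<otimes> q' \<in> short_monomials X n (head G f)"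
          "V (head G f) \<otimes> p = p" "q' \<otimes> V (head G h) = q'" using split by blast
        have "E' e \<otimes> m \<otimes> E e = ((E' e \<otimes> E f) \<otimes> p) \<otimes> (q' \<otimes> (E' h \<otimes> E e))"
          using * e' by (simp add: m_assoc)
        then show "E' e \<otimes> m \<otimes> E e \<in> finite_sums (short_monomials X n (head G e))"
          using * e' by (auto simp: E'_E finite_sums.zero
            intro!: finite_sums_summand short_monomials_closed[THEN subsetD] short_monomials_closed)
      qed (use e' short_monomials_closed in auto)
      have "V (head G e) = E' e \<otimes> V w \<otimes> E e" using e' E'_V[of e] by (simp add: E'_E)
      then have "V (head G e) \<oplus> E' e \<otimes> y \<otimes> E e = E' e \<otimes> (V w \<oplus> y) \<otimes> E e"
        using e' Suc(2) y by (simp add: l_distr r_distr)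
      then show "V (head G e) \<oplus> E' e \<otimes> y \<otimes> E e = E' e \<otimes> y \<otimes> E e" using Suc(4) by simp
    qed
    moreover have "F \<subseteq> arcs G" using F(2) by auto
    ultimately have "range_projection F \<in> I"
      using F(2) by (intro range_projection_in_ideal[OF I F(1)]) (simp_all add: subset_iff)
    with vertex_eq_range_projection[OF Suc(2) F(1,2) y Suc(4) F(3)] notin show False by simp
  qed
qed

lemma finite_sums_monomials_short:
  assumes "y \<in> finite_sums (monomials X w w)"
  obtains n where "y \<in> finite_sums (short_monomials X n w)"
proof -
  have "\<exists>n. y \<in> finite_sums (short_monomials X n w)"
    using assms
  proof (induction rule: finite_sums.induct)
    case (add m y)
    then obtain n where n: "y \<in> finite_sums (short_monomials X n w)" by blast
    obtain k l x p p' q q' where *: "x \<in> X" "path k w x p p'" "path l w x q q'" "m = p \<otimes> q'"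
      using add(1) by (rule monomialsE)
    have "m \<in> short_monomials X (max n (Suc k)) w" unfolding short_monomials_def using * less_max_iff_disj by blast
    moreover have "y \<in> finite_sums (short_monomials X (max n (Suc k)) w)"
      using n by (rule finite_sums_mono) (unfold short_monomials_def, use less_max_iff_disj in blast)
    ultimately show ?case using finite_sums.add by blast
  qed (use finite_sums.zero in blast)
  with that show thesis by blast
qed

text \<open>The sums of monomials through vertices of \<open>I\<close> form an ideal \<open>J\<close>. It contains a nonzero vertex, so it is
  cofinal, and the descent along edges applies to each vertex.\<close>

lemma vertices_in_ideal:
  assumes I: "hemiring_ideal A I" "I \<noteq> {\<zero>}" and w: "w \<in> verts G"
  shows "V w \<in> I"
proof -
  note I' = hemiring_idealD[OF I(1)]
  define X where "X = {x \<in> verts G. V x \<in> I}"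
  have X: "hereditary X" unfolding hereditary_def
  proof (intro conjI allI impI)
    fix k x y r r' assume x: "x \<in> X" and r: "path k x y r r'"
    note closed = path_closed[OF r]
    have "V y = r' \<otimes> V x \<otimes> r" using path_ghost_path[OF r] path_ends[OF r] by simp
    also have "\<dots> \<in> I" using x closed I' by (auto simp: X_def)
    finally show "y \<in> X" using closed by (simp add: X_def)
  qed (auto simp: X_def)
  define J where "J = finite_sums (all_monomials X)"
  have J: "hemiring_ideal A J"
  proof (rule hemiring_idealI)
    show "J \<subseteq> carrier A" unfolding J_def using finite_sums_closed[OF _ all_monomials_closed] by blast
    show "\<zero> \<in> J" by (simp add: J_def finite_sums.zero)
    show "a \<oplus> b \<in> J" if "a \<in> J" "b \<in> J" for a b
      using that all_monomials_closed by (simp add: J_def finite_sums_add)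
    have inter: "verts G \<inter> X = X" "X \<inter> verts G = X" by (auto simp: X_def)
    show "x \<otimes> a \<in> J" "a \<otimes> x \<in> J" if "a \<in> J" "x \<in> carrier A" for a x
      using that finite_sums_all_monomials_mult[OF hereditary_verts X, of x a]
        finite_sums_all_monomials_mult[OF X hereditary_verts, of a x]
      by (simp_all add: J_def carrier_eq_sums inter)
  qed
  obtain v where v: "v \<in> verts G" "V v \<noteq> \<zero>" "V v \<in> I" by (rule nonzero_vertex_in_ideal[OF I])
  have "V v \<in> monomials X v v" using monomialsI[of v X, OF _ trivial trivial] v by (simp add: X_def V_V)
  then have "V v \<in> J" using v finite_sums_summand[OF _ all_monomials_closed] by (auto simp: J_def all_monomials_def)
  with v have "J \<noteq> {\<zero>}" by auto
  then obtain a b where ab: "a \<in> J" "b \<in> J" "V w \<oplus> a = b" by (rule ideal_absorbs[OF simple J _ V_closed[OF w]])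
  have closed: "a \<in> carrier A" "b \<in> carrier A" using ab hemiring_idealD(1)[OF J] by auto
  define y where "y = V w \<otimes> b \<otimes> V w"
  have "V w \<oplus> b = b" using w closed by (simp add: add_idem flip: ab(3) a_assoc)
  then have "y = V w \<otimes> (V w \<oplus> b) \<otimes> V w" by (simp add: y_def)
  also have "\<dots> = V w \<oplus> y" using w closed by (simp add: y_def l_distr r_distr V_V)
  finally have below: "V w \<oplus> y = y" ..
  have "y \<in> finite_sums (monomials X w w)" unfolding y_def
  proof (rule finite_sums_conjugate[of b "all_monomials X"])
    show "V w \<otimes> m \<otimes> V w \<in> finite_sums (monomials X w w)" if m: "m \<in> all_monomials X" for m
    proof -
      obtain u u' where u: "u \<in> verts G" "u' \<in> verts G" "m \<in> monomials X u u'"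
        using m unfolding all_monomials_def by blast
      then show ?thesis
        using w monomials_V[OF u(3) w] finite_sums_summand[OF _ monomials_closed]
        by (auto simp: finite_sums.zero)
    qed
  qed (use ab w all_monomials_closed monomials_closed in \<open>auto simp: J_def\<close>)
  then obtain n where "y \<in> finite_sums (short_monomials X n w)" by (rule finite_sums_monomials_short)
  moreover have "V x \<in> I" if "x \<in> X" for x using that by (simp add: X_def)
  ultimately show ?thesis using vertex_below_short_monomials[OF I(1) _ w _ below] by blast
qed

end


section \<open>Ideal-simplicity\<close>

context path_algebra
begin

theorem congruence_simple_imp_ideal_simple:
  assumes simple: "congruence_simple A"
  shows "ideal_simple A"
  unfolding ideal_simple_def
proof (intro allI impI)
  fix I assume I: "hemiring_ideal A I"
  note I' = hemiring_idealD[OF I]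
  show "I = {\<zero>} \<or> I = carrier A"
  proof (cases "carrier A = {\<zero>} \<or> I = {\<zero>}")
    case True
    then show ?thesis using I' by auto
  next
    case False
    have "V v \<in> I" if v: "v \<in> verts G" for v
    proof (rule ring_or_zerosumfree[OF simple])
      assume ring: "\<And>x. x \<in> carrier A \<Longrightarrow> \<exists>y\<in>carrier A. x \<oplus> y = \<zero>"
      obtain a b where ab: "a \<in> I" "b \<in> I" "V v \<oplus> a = b"
        using ideal_absorbs[OF simple I _ V_closed[OF v]] False by blast
      obtain u where u: "u \<in> carrier A" "V v \<oplus> u = \<zero>" using ring[OF V_closed[OF v]] by blast
      have closed: "a \<in> carrier A" "b \<in> carrier A" using ab I' by auto
      \<comment> \<open>Multiply \<open>v + a = b\<close> by \<open>v\<close> and cancel \<open>v a\<close> with \<open>u a\<close>.\<close>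
      have "V v \<otimes> b \<oplus> u \<otimes> a = V v \<oplus> (V v \<oplus> u) \<otimes> a"
        using v u(1) closed by (simp add: r_distr l_distr V_V a_assoc flip: ab(3))
      also have "\<dots> = V v" using v u closed by simp
      finally show ?thesis using I' ab u v by (metis V_closed)
    next
      assume zerosumfree: "\<And>x y. \<lbrakk>x \<in> carrier A; y \<in> carrier A; x \<oplus> y = \<zero>\<rbrakk> \<Longrightarrow> x = \<zero>"
      interpret idempotent_simple_path_algebra A G V E E'
      proof unfold_locales
        show "x = \<zero>" if "x \<in> carrier A" "y \<in> carrier A" "x \<oplus> y = \<zero>" for x y
          using zerosumfree[OF that] .
        show "carrier A \<noteq> {\<zero>}" using False by blast
      qed (rule simple)
      show ?thesis using False by (intro vertices_in_ideal[OF I _ v]) blast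
    qed
    then show ?thesis using ideal_eq_carrier[OF I] by blast
  qed
qed

end


section \<open>Leavitt path algebras\<close>

text \<open>The generation property is induction on the terms that represent the elements.\<close>

lemma path_algebra_leavitt_path_algebra:
  fixes \<Gamma> :: "('v, 'e) pre_digraph"
  assumes "wf_digraph \<Gamma>"
  defines "c \<equiv> \<lambda>x. term_class (leavitt_gens \<Gamma>) (leavitt_relations \<Gamma>) (TGen x)"
  shows "path_algebra (leavitt_path_algebra TYPE('s::{comm_semiring_0, comm_monoid_mult}) \<Gamma>) \<Gamma>
    (\<lambda>v. c (Vertex v)) (\<lambda>e. c (Edge e)) (\<lambda>e. c (Ghost e))"
proof -
  interpret wf_digraph \<Gamma> by fact
  let ?X = "leavitt_gens \<Gamma>"
  let ?\<R> = "leavitt_relations \<Gamma> :: ('s, ('v, 'e) leavitt_gen) alg_term rel"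
  have rel: "term_class ?X ?\<R> t = term_class ?X ?\<R> u" if "(t, u) \<in> leavitt_relations \<Gamma>" for t u
    using that leavitt_relations_closed[OF assms(1) that] by (intro term_class_relation) auto
  have gens: "Vertex v \<in> ?X \<longleftrightarrow> v \<in> verts \<Gamma>" "Edge e \<in> ?X \<longleftrightarrow> e \<in> arcs \<Gamma>" "Ghost e \<in> ?X \<longleftrightarrow> e \<in> arcs \<Gamma>"
    for v e by (auto simp: leavitt_gens_def)
  show ?thesis
  proof (intro path_algebra.intro path_algebra_axioms.intro semiring_algebra_leavitt_path_algebra assms(1))
    fix B
    assume B: "\<And>v. v \<in> verts \<Gamma> \<Longrightarrow> c (Vertex v) \<in> B" "\<And>e. e \<in> arcs \<Gamma> \<Longrightarrow> c (Edge e) \<in> B"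
      "\<And>e. e \<in> arcs \<Gamma> \<Longrightarrow> c (Ghost e) \<in> B" "\<zero>\<^bsub>leavitt_path_algebra TYPE('s) \<Gamma>\<^esub> \<in> B"
      "\<And>x y. \<lbrakk>x \<in> B; y \<in> B\<rbrakk> \<Longrightarrow> x \<oplus>\<^bsub>leavitt_path_algebra TYPE('s) \<Gamma>\<^esub> y \<in> B"
      "\<And>x y. \<lbrakk>x \<in> B; y \<in> B\<rbrakk> \<Longrightarrow> x \<otimes>\<^bsub>leavitt_path_algebra TYPE('s) \<Gamma>\<^esub> y \<in> B"
      "\<And>s x. x \<in> B \<Longrightarrow> s \<odot>\<^bsub>leavitt_path_algebra TYPE('s) \<Gamma>\<^esub> x \<in> B"
    have "term_class ?X ?\<R> t \<in> B" if "t \<in> terms_over ?X" for t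
      using that
    proof (induction t)
      case (TGen x)
      then show ?case using B(1-3) by (auto simp: leavitt_gens_def c_def)
    next
      case TZero
      then show ?case using B(4) by (simp add: leavitt_path_algebra_def zero_presented_algebra)
    next
      case (TAdd t u)
      then show ?case using B(5) by (simp add: leavitt_path_algebra_def flip: add_presented_algebra)
    next
      case (TMult t u)
      then show ?case using B(6) by (simp add: leavitt_path_algebra_def flip: mult_presented_algebra)
    next
      case (TSmult s t)
      then show ?case using B(7) by (simp add: leavitt_path_algebra_def flip: smult_presented_algebra)
    qed
    then show "carrier (leavitt_path_algebra TYPE('s) \<Gamma>) \<subseteq> B"
      by (auto simp: leavitt_path_algebra_def carrier_presented_algebra)
  qed (auto simp: leavitt_path_algebra_def carrier_presented_algebra c_def gens presented_algebra_simps
      intro!: rel leavitt_relations.intros)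
qed

theorem corollary4p2:
  fixes \<Gamma> :: "('v, 'e) pre_digraph"
  assumes "wf_digraph \<Gamma>"
    and "congruence_simple
           (leavitt_path_algebra TYPE('s::{comm_semiring_0, comm_monoid_mult}) \<Gamma>)"
  shows "ideal_simple (leavitt_path_algebra TYPE('s) \<Gamma>)"
  using path_algebra.congruence_simple_imp_ideal_simple[OF path_algebra_leavitt_path_algebra] assms by blast

end
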